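(* Let $n\ge 4$ and let $\mathcal{G}$ be an indecomposable $\mathrm{MD}_{n-1}(n)$-algebra, i.e. an indecomposable $n$-dimensional real solvable Lie algebra all of whose nontrivial coadjoint orbits have dimension exactly $n-1$ (and which has at least one nontrivial coadjoint orbit). Then $\mathcal{G}$ is isomorphic to one of the following Lie algebras: 1. The real Heisenberg Lie algebra $\mathfrak{h}_{2m+1}$ for some positive integer $m$, with basis $\{x_i,y_i,z : i=1,\dots,m\}$ and non-zero Lie brackets given by $[x_i,y_i]=z$ for every $1\le i\le m$. 2. The real Lie algebra $\mathfrak{s}_{5,45}$ with basis $\{x_1,x_2,y_1,y_2,z\}$ and non-zero Lie brackets given by $$[x_1,y_1]=y_1,\quad [x_1,y_2]=y_2,\quad [x_1,z]=2z,\quad [x_2,y_1]=y_2,\quad [x_2,y_2]=-y_1,\quad [y_1,y_2]=z.$$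
   Context: All Lie algebras are finite-dimensional solvable real Lie algebras. When a Lie algebra is described by a basis and its non-zero brackets, all brackets of basis elements not determined by the listed ones via skew-symmetry are zero. A Lie algebra is decomposable if it is a direct sum of two nonzero ideals, and indecomposable otherwise. Let $G$ be the simply connected Lie group with Lie algebra $\mathcal{G}$. The coadjoint representation of $G$ on the dual space $\mathcal{G}^*$ is $K_g(F)(x)=F(\mathrm{Ad}(g^{-1})x)$ for $g\in G$, $F\in\mathcal{G}^*$, $x\in\mathcal{G}$. The coadjoint orbit (or $K$-orbit) of $F$ is $\Omega_F=\{K_g(F): g\in G\}$; it is called trivial if $\dim\Omega_F=0$ and nontrivial otherwise. $\mathcal{G}$ is called an MD-algebra if all of its nontrivial coadjoint orbits have one and the same (positive) dimension. If nontrivial coadjoint orbits exist and their common dimension is $k>0$, $\mathcal{G}$ is called an $\mathrm{MD}_k$-algebra; if moreover $\dim\mathcal{G}=n$, it is called an $\mathrm{MD}_k(n)$-algebra. *)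

theory Defs
  imports "HOL-Analysis.Analysis"
begin

locale real_lie_algebra =
  fixes br :: "'a::euclidean_space \<Rightarrow> 'a \<Rightarrow> 'a"
  assumes bilinear_br: "bilinear br"
    and br_self: "br x x = 0"
    and jacobi: "br x (br y z) + br y (br z x) + br z (br x y) = 0"

fun derived_series :: "('a::euclidean_space \<Rightarrow> 'a \<Rightarrow> 'a) \<Rightarrow> nat \<Rightarrow> 'a set" where
  "derived_series br 0 = UNIV"
| "derived_series br (Suc k) =
     span {br x y | x y. x \<in> derived_series br k \<and> y \<in> derived_series br k}"

definition solvable_lie :: "('a::euclidean_space \<Rightarrow> 'a \<Rightarrow> 'a) \<Rightarrow> bool" where
  "solvable_lie br \<longleftrightarrow> (\<exists>k. derived_series br k = {0})"

definition lie_ideal :: "('a::euclidean_space \<Rightarrow> 'a \<Rightarrow> 'a) \<Rightarrow> 'a set \<Rightarrow> bool" where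
  "lie_ideal br I \<longleftrightarrow> subspace I \<and> (\<forall>x. \<forall>y\<in>I. br x y \<in> I)"

definition decomposable :: "('a::euclidean_space \<Rightarrow> 'a \<Rightarrow> 'a) \<Rightarrow> bool" where
  "decomposable br \<longleftrightarrow>
     (\<exists>I J. lie_ideal br I \<and> lie_ideal br J \<and> I \<noteq> {0} \<and> J \<noteq> {0} \<and>
            I \<inter> J = {0} \<and> {x + y | x y. x \<in> I \<and> y \<in> J} = UNIV)"

definition exp_ad :: "('a::euclidean_space \<Rightarrow> 'a \<Rightarrow> 'a) \<Rightarrow> 'a \<Rightarrow> 'a \<Rightarrow> 'a" where
  "exp_ad br x y = (\<Sum>k. (1 / fact k) *\<^sub>R ((br x ^^ k) y))"

text \<open>
  The set of operators Ad(g), where g runs through the simply connected Lie group G with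
  the given Lie algebra. Since G is connected, it is generated by the elements exp x, and
  Ad(exp x) is the exponential of ad x. The inverse of a generator is again a generator, so
  finite products suffice.
\<close>
inductive_set Ad_group :: "('a::euclidean_space \<Rightarrow> 'a \<Rightarrow> 'a) \<Rightarrow> ('a \<Rightarrow> 'a) set"
  for br where
  Ad_one: "id \<in> Ad_group br"
| Ad_mult: "A \<in> Ad_group br \<Longrightarrow> exp_ad br x \<circ> A \<in> Ad_group br"

text \<open>
  The coadjoint action K_g(F)(x) = F(Ad(g^{-1}) x), written in terms of the operator A = Ad(g).
\<close>
definition coadjoint :: "('a::euclidean_space \<Rightarrow> 'a) \<Rightarrow> ('a \<Rightarrow>\<^sub>L real) \<Rightarrow> ('a \<Rightarrow>\<^sub>L real)" where
  "coadjoint A F = Blinfun (\<lambda>x. blinfun_apply F (inv A x))"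

definition coadjoint_orbit ::
    "('a::euclidean_space \<Rightarrow> 'a \<Rightarrow> 'a) \<Rightarrow> ('a \<Rightarrow>\<^sub>L real) \<Rightarrow> ('a \<Rightarrow>\<^sub>L real) set" where
  "coadjoint_orbit br F = {coadjoint A F | A. A \<in> Ad_group br}"

definition coadjoint_orbits ::
    "('a::euclidean_space \<Rightarrow> 'a \<Rightarrow> 'a) \<Rightarrow> ('a \<Rightarrow>\<^sub>L real) set set" where
  "coadjoint_orbits br = range (coadjoint_orbit br)"

text \<open>
  The Lie algebra of the stabilizer G_F: those x whose one-parameter subgroup exp(tx) lies
  in G_F.
\<close>
definition stabilizer_lie ::
    "('a::euclidean_space \<Rightarrow> 'a \<Rightarrow> 'a) \<Rightarrow> ('a \<Rightarrow>\<^sub>L real) \<Rightarrow> 'a set" where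
  "stabilizer_lie br F = {x. \<forall>t::real. coadjoint (exp_ad br (t *\<^sub>R x)) F = F}"

text \<open>
  An orbit carries the manifold structure of the homogeneous space G/G_F, so its dimension is
  dim G - dim G_F. Stabilizers of points of the same orbit are conjugate, so the number does not
  depend on the base point F.
\<close>
definition orbit_dim ::
    "('a::euclidean_space \<Rightarrow> 'a \<Rightarrow> 'a) \<Rightarrow> ('a \<Rightarrow>\<^sub>L real) set \<Rightarrow> nat" where
  "orbit_dim br \<Omega> = (THE d. \<forall>F\<in>\<Omega>. d + dim (stabilizer_lie br F) = DIM('a))"

definition nontrivial_orbits ::
    "('a::euclidean_space \<Rightarrow> 'a \<Rightarrow> 'a) \<Rightarrow> ('a \<Rightarrow>\<^sub>L real) set set" where
  "nontrivial_orbits br = {\<Omega> \<in> coadjoint_orbits br. orbit_dim br \<Omega> \<noteq> 0}"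

definition MD_algebra :: "('a::euclidean_space \<Rightarrow> 'a \<Rightarrow> 'a) \<Rightarrow> bool" where
  "MD_algebra br \<longleftrightarrow> real_lie_algebra br \<and> solvable_lie br \<and>
     (\<forall>\<Omega>\<in>nontrivial_orbits br. \<forall>\<Omega>'\<in>nontrivial_orbits br. orbit_dim br \<Omega> = orbit_dim br \<Omega>')"

definition MD_k_algebra :: "nat \<Rightarrow> ('a::euclidean_space \<Rightarrow> 'a \<Rightarrow> 'a) \<Rightarrow> bool" where
  "MD_k_algebra k br \<longleftrightarrow> MD_algebra br \<and> (\<exists>\<Omega>\<in>nontrivial_orbits br. orbit_dim br \<Omega> = k)"

definition MD_kn_algebra :: "nat \<Rightarrow> nat \<Rightarrow> ('a::euclidean_space \<Rightarrow> 'a \<Rightarrow> 'a) \<Rightarrow> bool" where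
  "MD_kn_algebra k n br \<longleftrightarrow> MD_k_algebra k br \<and> DIM('a) = n"

text \<open>
  A Lie algebra described by its non-zero brackets is encoded by a set B of names of basis
  elements and a set T of tuples: (a, b, c, d) in T stands for [a, b] = c d. Brackets of
  basis elements a, b with neither [a, b] nor [b, a] listed are zero. An isomorphism from the
  algebra so described to the one with bracket br is the same as a basis e, indexed by B, that
  satisfies these relations.
\<close>
definition lie_iso_described ::
    "('a::euclidean_space \<Rightarrow> 'a \<Rightarrow> 'a) \<Rightarrow> 'g set \<Rightarrow> ('g \<times> 'g \<times> real \<times> 'g) set \<Rightarrow> bool" where
  "lie_iso_described br B T \<longleftrightarrow>
     (\<exists>e. inj_on e B \<and> independent (e ` B) \<and> span (e ` B) = UNIV \<and>
        (\<forall>(a, b, c, d)\<in>T. br (e a) (e b) = c *\<^sub>R e d) \<and>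
        (\<forall>a\<in>B. \<forall>b\<in>B. (\<forall>c d. (a, b, c, d) \<notin> T \<and> (b, a, c, d) \<notin> T) \<longrightarrow> br (e a) (e b) = 0))"

datatype gen = gx nat | gy nat | gz

definition heisenberg_basis :: "nat \<Rightarrow> gen set" where
  "heisenberg_basis m = gx ` {1..m} \<union> gy ` {1..m} \<union> {gz}"

definition heisenberg_brackets :: "nat \<Rightarrow> (gen \<times> gen \<times> real \<times> gen) set" where
  "heisenberg_brackets m = {(gx i, gy i, 1, gz) | i. i \<in> {1..m}}"

definition s545_basis :: "gen set" where
  "s545_basis = {gx 1, gx 2, gy 1, gy 2, gz}"

definition s545_brackets :: "(gen \<times> gen \<times> real \<times> gen) set" where
  "s545_brackets =
     {(gx 1, gy 1, 1, gy 1), (gx 1, gy 2, 1, gy 2), (gx 1, gz, 2, gz),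
      (gx 2, gy 1, 1, gy 2), (gx 2, gy 2, -1, gy 1), (gy 1, gy 2, 1, gz)}"

end

theory Submission
  imports Defs "HOL-Computational_Algebra.Fundamental_Theorem_Algebra"
begin

text \<open>
  For a functional \<open>F\<close> let \<open>B\<^sub>F (x, y) = F [x, y]\<close>. The Lie algebra of the stabilizer of \<open>F\<close> is the
  radical of \<open>B\<^sub>F\<close>, so the hypothesis says: whenever \<open>F\<close> does not vanish on the derived algebra
  \<open>G' = [G, G]\<close>, the radical of \<open>B\<^sub>F\<close> is a line (\<open>MD_imp_line_radical_algebra\<close>). In particular the
  dimension is odd (\<open>dim_ge_5\<close>).

  The main tool is \<open>ideal_dichotomy\<close>: an ideal of dimension at least two contains \<open>G'\<close>, because
  otherwise a functional that vanishes on the ideal but not on \<open>G'\<close> would have the ideal in its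
  radical. By solvability, \<open>G'' = [G', G']\<close> has dimension at most one, and it is central in \<open>G'\<close>.

  If \<open>G'\<close> is a line, the bracket is a scalar form with a one-dimensional radical, the centre. Either
  the centre equals \<open>G'\<close> and a symplectic basis identifies the algebra with a Heisenberg algebra,
  or the centre splits off (\<open>heisenberg_or_decomposable\<close>).

  Otherwise \<open>G\<close> acts on \<open>G' / G''\<close> by commuting operators whose proper invariant subspaces are at most
  lines. By the fundamental theorem of algebra this forces \<open>G' / G''\<close> to be a plane (\<open>dim_le_2\<close>,
  \<open>dim_quotient_plane\<close>), and the operators lie in \<open>\<langle>1, T\<rangle>\<close> for a single operator \<open>T\<close>. Were the
  identity not induced by an element of \<open>G\<close>, a subspace of codimension at most one would be isotropic
  for a suitable \<open>F\<close>, too large for a line radical; so some \<open>x1\<close> acts as the identity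
  (\<open>grading_element_exists\<close>). Its eigenvalues on \<open>G'\<close> are 1 and 2, so \<open>G\<close> is the sum of \<open>G'\<close> and the
  abelian kernel \<open>H\<close> of \<open>ad x1\<close>, and \<open>G' = P + G''\<close> with an \<open>H\<close>-invariant plane \<open>P\<close> of eigenvectors. An
  element of \<open>H\<close> that kills \<open>P\<close> is central and would split off, so \<open>H\<close> acts faithfully and has dimension at
  most two. As the dimension is odd and at least five, \<open>G'' \<noteq> 0\<close> and the dimension is five. A common
  eigenvector of \<open>H\<close> in \<open>P\<close> would give a two-dimensional ideal that does not contain \<open>G'\<close>; hence \<open>H\<close>
  contains an element acting on \<open>P\<close> as a complex structure, which yields the relations of
  the five-dimensional algebra (\<open>s545\<close>).
\<close>

section \<open>Linear algebra\<close>

text \<open>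
  The inner product with the component of \<open>u\<close> orthogonal to \<open>U\<close>, suitably scaled.
\<close>
lemma functional_separating_subspace:
  fixes U :: "'a::euclidean_space set"
  assumes "subspace U" "u \<notin> U"
  obtains f :: "'a \<Rightarrow> real" where "linear f" "\<And>x. x \<in> U \<Longrightarrow> f x = 0" "f u = 1"
proof -
  obtain y z where y: "y \<in> span U" and z: "\<And>w. w \<in> span U \<Longrightarrow> orthogonal z w" and u: "u = y + z"
    using orthogonal_subspace_decomp_exists[of U u] by blast
  have sp: "span U = U" using assms(1) by (simp add: span_eq_iff)
  have z0: "z \<noteq> 0" using assms(2) y u sp by auto
  have "linear (\<lambda>x. z \<bullet> x / (z \<bullet> z))"
    by (intro linearI) (auto simp: inner_add_right add_divide_distrib)
  moreover have "z \<bullet> x / (z \<bullet> z) = 0" if "x \<in> U" for x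
    using z[of x] that sp by (simp add: orthogonal_def)
  moreover have "z \<bullet> u / (z \<bullet> z) = 1"
    using z[OF y] z0 by (simp add: u inner_add_right orthogonal_def)
  ultimately show thesis by (rule that)
qed

text \<open>
  Linear independence of an indexed family; comparing two indices with equal values gives the
  injectivity as well.
\<close>
lemma independent_familyI:
  fixes e :: "'g \<Rightarrow> 'a::real_vector"
  assumes "finite B"
    and zero: "\<And>c. (\<Sum>b\<in>B. c b *\<^sub>R e b) = 0 \<Longrightarrow> \<forall>b\<in>B. c b = 0"
  shows "inj_on e B \<and> independent (e ` B)"
proof
  show inj: "inj_on e B"
  proof (rule inj_onI, rule ccontr)
    fix a b assume ab: "a \<in> B" "b \<in> B" "e a = e b" "a \<noteq> b"
    let ?c = "\<lambda>x. (if x = a then 1 else 0) - (if x = b then 1 else 0) :: real"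
    have "(\<Sum>x\<in>B. ?c x *\<^sub>R e x)
        = (\<Sum>x\<in>B. (if x = a then e x else 0)) - (\<Sum>x\<in>B. (if x = b then e x else 0))"
      unfolding sum_subtractf[symmetric]
      by (rule sum.cong) auto
    also have "\<dots> = 0" using ab assms(1) by simp
    finally have "?c a = 0" using zero[of ?c] ab by blast
    then show False using ab by simp
  qed
  show "independent (e ` B)"
  proof (rule independent_if_scalars_zero)
    fix f x assume s: "(\<Sum>x\<in>e ` B. f x *\<^sub>R x) = 0" and x: "x \<in> e ` B"
    have "(\<Sum>b\<in>B. f (e b) *\<^sub>R e b) = 0" using s by (simp add: sum.reindex[OF inj])
    from zero[OF this] x show "f x = 0" by blast
  qed (use assms(1) in simp)
qed

lemma subspace_line:
  fixes U :: "'a::euclidean_space set"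
  assumes "subspace U" "dim U \<le> 1"
  obtains z where "U = span {z}"
proof (cases "U = {0}")
  case True then show thesis using that[of 0] by simp
next
  case False
  then obtain z where z: "z \<in> U" "z \<noteq> 0" using assms(1) subspace_0 by blast
  have "span {z} = U"
  proof (rule subspace_dim_equal)
    show "span {z} \<subseteq> U" using z assms(1) by (simp add: span_minimal)
    show "dim U \<le> dim (span {z})" using z assms(2) by simp
  qed (use assms(1) in auto)
  then show thesis using that by blast
qed

lemma subspace_line_eq_span:
  fixes U :: "'a::euclidean_space set"
  assumes "subspace U" "dim U \<le> 1" "z \<in> U" "z \<noteq> 0"
  shows "U = span {z}"
  using assms by (metis dim_singleton dim_span empty_subsetI insert_subset span_minimal
      subspace_dim_equal subspace_span)

lemma nonzero_vector_of_dim: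
  fixes U :: "'a::euclidean_space set"
  assumes "dim U > 0"
  obtains r where "r \<in> U" "r \<noteq> 0"
proof -
  have "\<not> U \<subseteq> {0}" using assms by (metis dim_eq_0 less_irrefl)
  then show thesis using that by blast
qed

lemma plane_spanned:
  fixes P :: "'a::euclidean_space set"
  assumes "subspace P" "dim P = 2" "v \<in> P" "v \<noteq> 0" "u \<in> P" "u \<notin> span {v}" "x \<in> P"
  obtains a b where "x = a *\<^sub>R v + b *\<^sub>R u"
proof -
  have "independent {u, v}" using assms(4,6) by (simp add: independent_insert)
  moreover have "u \<noteq> v" using assms(6) by (auto simp: span_base)
  ultimately have "dim {u, v} = 2" by (simp add: dim_eq_card_independent)
  then have "span {u, v} = P"
    using assms(1-3,5) by (intro subspace_dim_equal) (auto simp: span_minimal)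
  then have "x \<in> span {u, v}" using assms(7) by simp
  then obtain b where "x - b *\<^sub>R u \<in> span {v}" by (auto simp: span_insert)
  then obtain a where "x - b *\<^sub>R u = a *\<^sub>R v" by (auto simp: span_singleton)
  then show thesis using that[of a b] by (simp add: algebra_simps)
qed

section \<open>Hyperbolic pairs of an alternating form\<close>

definition pair_indices :: "nat \<Rightarrow> gen set" where
  "pair_indices m = gx ` {1..m} \<union> gy ` {1..m}"

lemma finite_pair_indices: "finite (pair_indices m)"
  by (simp add: pair_indices_def)

lemma heisenberg_basis_eq: "heisenberg_basis m = insert gz (pair_indices m)"
  by (auto simp: heisenberg_basis_def pair_indices_def)

lemma card_pair_indices: "card (pair_indices m) = 2 * m"
proof -
  have "card (gx ` {1..m} \<union> gy ` {1..m}) = card (gx ` {1..m}) + card (gy ` {1..m})"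
    by (rule card_Un_disjoint) auto
  then show ?thesis by (simp add: pair_indices_def card_image inj_on_def)
qed

lemma card_heisenberg_basis: "card (heisenberg_basis m) = 2 * m + 1"
proof -
  have "gz \<notin> pair_indices m" by (auto simp: pair_indices_def)
  then show ?thesis
    by (simp add: heisenberg_basis_eq finite_pair_indices card_pair_indices)
qed

definition hyperbolic :: "('a \<Rightarrow> 'a \<Rightarrow> real) \<Rightarrow> nat \<Rightarrow> (gen \<Rightarrow> 'a) \<Rightarrow> bool" where
  "hyperbolic w m e \<longleftrightarrow>
     (\<forall>i\<in>{1..m}. \<forall>j\<in>{1..m}. w (e (gx i)) (e (gy j)) = (if i = j then 1 else 0) \<and>
        w (e (gx i)) (e (gx j)) = 0 \<and> w (e (gy i)) (e (gy j)) = 0)"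

lemma hyperbolicD:
  assumes "hyperbolic w m e" "i \<in> {1..m}" "j \<in> {1..m}"
  shows "w (e (gx i)) (e (gy j)) = (if i = j then 1 else 0)"
    "w (e (gx i)) (e (gx j)) = 0" "w (e (gy i)) (e (gy j)) = 0"
  using assms by (auto simp: hyperbolic_def)

locale alternating_form =
  fixes w :: "'a::euclidean_space \<Rightarrow> 'a \<Rightarrow> real"
  assumes bilinear_w: "bilinear w" and w_self: "w x x = 0"
begin

lemma w_anti: "w x y = - w y x"
proof -
  have "w (x + y) (x + y) = 0" by (rule w_self)
  then have "w x y + w y x = 0"
    using bilinear_ladd[OF bilinear_w, of x y "x + y"] bilinear_radd[OF bilinear_w, of _ x y]
    by (simp add: w_self)
  then show ?thesis by linarith
qed

lemmas w_simps = bilinear_ladd[OF bilinear_w] bilinear_radd[OF bilinear_w]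
  bilinear_lmul[OF bilinear_w] bilinear_rmul[OF bilinear_w] bilinear_lzero[OF bilinear_w]
  bilinear_rzero[OF bilinear_w] bilinear_lsub[OF bilinear_w] bilinear_rsub[OF bilinear_w]

lemma w_sum_left: "w (\<Sum>i\<in>A. c i *\<^sub>R g i) v = (\<Sum>i\<in>A. c i * w (g i) v)"
proof -
  have "linear (\<lambda>u. w u v)" using bilinear_w by (simp add: bilinear_def)
  then show ?thesis
    using linear_sum[of "\<lambda>u. w u v" "\<lambda>i. c i *\<^sub>R g i" A] by (simp add: w_simps)
qed

lemma hyperbolic_coefficient_x:
  assumes "hyperbolic w m e" "j \<in> {1..m}"
  shows "w (\<Sum>b\<in>pair_indices m. c b *\<^sub>R e b) (e (gy j)) = c (gx j)"
proof -
  have "(\<Sum>b\<in>pair_indices m. c b * w (e b) (e (gy j)))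
      = (\<Sum>b\<in>pair_indices m. if b = gx j then c b else 0)"
    using assms(2) by (intro sum.cong) (auto simp: pair_indices_def hyperbolicD[OF assms(1)] split: if_splits)
  also have "\<dots> = c (gx j)"
    using assms(2) finite_pair_indices by (simp add: pair_indices_def)
  finally show ?thesis by (simp add: w_sum_left)
qed

lemma hyperbolic_coefficient_y:
  assumes "hyperbolic w m e" "j \<in> {1..m}"
  shows "w (\<Sum>b\<in>pair_indices m. c b *\<^sub>R e b) (e (gx j)) = - c (gy j)"
proof -
  have "(\<Sum>b\<in>pair_indices m. c b * w (e b) (e (gx j)))
      = (\<Sum>b\<in>pair_indices m. if b = gy j then - c b else 0)"
    using assms(2) w_anti[of "e (gy _)" "e (gx j)"]
    by (intro sum.cong) (auto simp: pair_indices_def hyperbolicD[OF assms(1)] split: if_splits)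
  also have "\<dots> = - c (gy j)"
    using assms(2) finite_pair_indices by (simp add: pair_indices_def)
  finally show ?thesis by (simp add: w_sum_left)
qed

lemma hyperbolic_coefficients_zero:
  assumes "hyperbolic w m e" "\<And>b. b \<in> pair_indices m \<Longrightarrow> w (\<Sum>b\<in>pair_indices m. c b *\<^sub>R e b) (e b) = 0"
  shows "\<forall>b\<in>pair_indices m. c b = 0"
proof
  fix b assume b: "b \<in> pair_indices m"
  then consider j where "j \<in> {1..m}" "b = gx j" | j where "j \<in> {1..m}" "b = gy j"
    by (auto simp: pair_indices_def)
  then show "c b = 0"
  proof cases
    case 1
    then show ?thesis
      using hyperbolic_coefficient_x[OF assms(1), of j c] assms(2)[of "gy j"]
      by (simp add: pair_indices_def)
  next
    case 2
    then show ?thesis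
      using hyperbolic_coefficient_y[OF assms(1), of j c] assms(2)[of "gx j"]
      by (simp add: pair_indices_def)
  qed
qed

lemma hyperbolic_bound:
  assumes "hyperbolic w m e"
  shows "2 * m \<le> DIM('a)"
proof -
  have "inj_on e (pair_indices m) \<and> independent (e ` pair_indices m)"
    by (rule independent_familyI[OF finite_pair_indices],
        rule hyperbolic_coefficients_zero[OF assms]) (simp add: w_simps)
  then show ?thesis
    using independent_bound[of "e ` pair_indices m"] by (simp add: card_image card_pair_indices)
qed

text \<open>
  Hyperbolic families are independent, so their length is bounded and a longest one exists. If two
  vectors orthogonal to it paired nontrivially, they would extend it by one more pair.
\<close>
lemma maximal_hyperbolic:
  obtains m e where "hyperbolic w m e"
    and "\<And>r s. \<lbrakk>\<And>b. b \<in> pair_indices m \<Longrightarrow> w r (e b) = 0;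
                 \<And>b. b \<in> pair_indices m \<Longrightarrow> w s (e b) = 0\<rbrakk> \<Longrightarrow> w r s = 0"
proof -
  let ?P = "\<lambda>m. \<exists>e. hyperbolic w m e"
  define m where "m = (GREATEST m. ?P m)"
  have P0: "?P 0" by (simp add: hyperbolic_def)
  have bd: "m \<le> DIM('a)" if "?P m" for m using that hyperbolic_bound by fastforce
  have Pm: "?P m" unfolding m_def by (rule GreatestI_nat[where P = ?P, OF P0 bd])
  have max: "k \<le> m" if "?P k" for k unfolding m_def by (rule Greatest_le_nat[where P = ?P, OF that bd])
  from Pm obtain e where e: "hyperbolic w m e" by blast
  have "w r s = 0" if r: "\<And>b. b \<in> pair_indices m \<Longrightarrow> w r (e b) = 0"
    and s: "\<And>b. b \<in> pair_indices m \<Longrightarrow> w s (e b) = 0" for r s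
  proof (rule ccontr)
    assume ne: "w r s \<noteq> 0"
    define e' where "e' = e(gx (Suc m) := r, gy (Suc m) := (1 / w r s) *\<^sub>R s)"
    have rr: "w r (e (gx i)) = 0" "w r (e (gy i)) = 0" "w s (e (gx i)) = 0" "w s (e (gy i)) = 0"
      "w (e (gx i)) r = 0" "w (e (gy i)) r = 0" "w (e (gx i)) s = 0" "w (e (gy i)) s = 0"
      if "i \<in> {1..m}" for i
      using r[of "gx i"] r[of "gy i"] s[of "gx i"] s[of "gy i"] that
        w_anti[of _ r] w_anti[of _ s] by (auto simp: pair_indices_def)
    have "hyperbolic w (Suc m) e'"
      using e rr ne unfolding hyperbolic_def
      by (auto simp: e'_def w_simps w_self le_Suc_eq)
    then have "Suc m \<le> m" using max by blast
    then show False by simp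
  qed
  with e show thesis by (rule that)
qed

text \<open>
  A maximal hyperbolic family leaves only the radical, so a form with a one-dimensional radical
  has a symplectic basis completed by any nonzero radical vector.
\<close>
lemma symplectic_basis_line_radical:
  assumes z: "\<And>y. w z y = 0" "z \<noteq> 0" and rad: "dim {x. \<forall>y. w x y = 0} = 1"
  obtains m e where "hyperbolic w m e" "e gz = z" "inj_on e (heisenberg_basis m)"
    "independent (e ` heisenberg_basis m)" "span (e ` heisenberg_basis m) = UNIV"
    "DIM('a) = 2 * m + 1"
proof -
  obtain m e0 where h0: "hyperbolic w m e0"
    and max0: "\<And>r s. \<lbrakk>\<And>b. b \<in> pair_indices m \<Longrightarrow> w r (e0 b) = 0;
                 \<And>b. b \<in> pair_indices m \<Longrightarrow> w s (e0 b) = 0\<rbrakk> \<Longrightarrow> w r s = 0"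
    using maximal_hyperbolic by metis
  define e where "e = e0(gz := z)"
  have ee: "e b = e0 b" if "b \<in> pair_indices m" for b
    using that by (auto simp: e_def pair_indices_def)
  have h: "hyperbolic w m e" using h0 by (simp add: hyperbolic_def e_def)
  have max: "w r s = 0" if "\<And>b. b \<in> pair_indices m \<Longrightarrow> w r (e b) = 0"
    "\<And>b. b \<in> pair_indices m \<Longrightarrow> w s (e b) = 0" for r s
    using max0[of r s] that ee by simp
  have ez: "e gz = z" by (simp add: e_def)
  have gz: "gz \<notin> pair_indices m" by (auto simp: pair_indices_def)
  let ?R = "{x. \<forall>y. w x y = 0}"
  have subR: "subspace ?R" by (auto simp: subspace_def w_simps)
  have R: "?R = span {z}" by (rule subspace_line_eq_span[OF subR]) (use rad z in auto)
  \<comment> \<open>The component of \<open>v\<close> in the span of the hyperbolic pairs.\<close>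
  define N where "N v = (\<Sum>b\<in>pair_indices m.
      (case b of gx i \<Rightarrow> w v (e (gy i)) | gy i \<Rightarrow> - w v (e (gx i)) | gz \<Rightarrow> 0) *\<^sub>R e b)" for v
  have N_orth: "w (v - N v) (e b) = 0" if "b \<in> pair_indices m" for v b
  proof -
    from that consider j where "j \<in> {1..m}" "b = gx j" | j where "j \<in> {1..m}" "b = gy j"
      by (auto simp: pair_indices_def)
    then show ?thesis
      by cases (simp_all add: w_simps N_def hyperbolic_coefficient_x[OF h] hyperbolic_coefficient_y[OF h])
  qed
  have N_rad: "v - N v \<in> ?R" for v
  proof (clarify)
    fix y
    have "w (v - N v) (N y) = - w (N y) (v - N v)" by (rule w_anti)
    also have "w (N y) (v - N v) = 0"
      unfolding N_def[of y] w_sum_left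
      by (intro sum.neutral ballI) (use N_orth w_anti[of _ "v - N v"] in simp)
    finally have "w (v - N v) (N y) = 0" by simp
    moreover have "w (v - N v) (y - N y) = 0"
      by (rule max) (use N_orth in auto)
    moreover have "w (v - N v) y = w (v - N v) (N y) + w (v - N v) (y - N y)"
      by (simp add: w_simps)
    ultimately show "w (v - N v) y = 0" by simp
  qed
  have "span (e ` heisenberg_basis m) = UNIV"
  proof -
    have "v \<in> span (e ` heisenberg_basis m)" for v
    proof -
      have "N v \<in> span (e ` heisenberg_basis m)"
        unfolding N_def heisenberg_basis_eq
        by (intro span_sum span_scale span_base) auto
      moreover have "v - N v \<in> span (e ` heisenberg_basis m)"
      proof -
        have "span {z} \<subseteq> span (e ` heisenberg_basis m)"
          by (rule span_mono) (simp add: heisenberg_basis_eq ez)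
        then show ?thesis using N_rad[of v] R by blast
      qed
      ultimately show ?thesis by (metis add_diff_cancel_left' diff_add_cancel span_add)
    qed
    then show ?thesis by blast
  qed
  moreover have ind: "inj_on e (heisenberg_basis m) \<and> independent (e ` heisenberg_basis m)"
  proof (rule independent_familyI)
    show "finite (heisenberg_basis m)" by (simp add: heisenberg_basis_eq finite_pair_indices)
    fix c assume "(\<Sum>b\<in>heisenberg_basis m. c b *\<^sub>R e b) = 0"
    then have s: "c gz *\<^sub>R z + (\<Sum>b\<in>pair_indices m. c b *\<^sub>R e b) = 0"
      using gz by (simp add: heisenberg_basis_eq finite_pair_indices ez)
    then have s': "(\<Sum>b\<in>pair_indices m. c b *\<^sub>R e b) = - (c gz *\<^sub>R z)"
      by (simp add: add_eq_0_iff)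
    have c0: "\<forall>b\<in>pair_indices m. c b = 0"
      by (rule hyperbolic_coefficients_zero[OF h])
         (simp add: s' z w_simps flip: scaleR_minus_left)
    then have "c gz *\<^sub>R z = 0" using s by simp
    then show "\<forall>b\<in>heisenberg_basis m. c b = 0"
      using c0 z(2) by (simp add: heisenberg_basis_eq)
  qed
  moreover have "DIM('a) = 2 * m + 1"
  proof -
    have "dim (e ` heisenberg_basis m) = card (e ` heisenberg_basis m)"
      using ind by (intro dim_eq_card_independent) blast
    moreover have "card (e ` heisenberg_basis m) = 2 * m + 1"
      using ind card_heisenberg_basis by (simp add: card_image)
    moreover have "dim (span (e ` heisenberg_basis m)) = dim (UNIV :: 'a set)"
      using \<open>span (e ` heisenberg_basis m) = UNIV\<close> by simp
    ultimately show ?thesis by simp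
  qed
  ultimately show thesis using that[OF h ez] by blast
qed

end

section \<open>Commuting operators\<close>

text \<open>
  The value \<open>p(T) v\<close>, evaluated by Horner's scheme.
\<close>
definition poly_op :: "('a::real_vector \<Rightarrow> 'a) \<Rightarrow> real poly \<Rightarrow> 'a \<Rightarrow> 'a" where
  "poly_op T p v = fold_coeffs (\<lambda>c w. c *\<^sub>R v + T w) p 0"

context
  fixes T :: "'a::real_vector \<Rightarrow> 'a"
  assumes linT: "linear T"
begin

lemma poly_op_0 [simp]: "poly_op T 0 v = 0"
  by (simp add: poly_op_def)

lemma poly_op_pCons [simp]: "poly_op T (pCons c p) v = c *\<^sub>R v + T (poly_op T p v)"
  by (cases "p = 0 \<and> c = 0") (auto simp: poly_op_def linear_0[OF linT])

lemma poly_op_add: "poly_op T (p + q) v = poly_op T p v + poly_op T q v"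
  by (induct p q rule: poly_induct2) (auto simp: linear_add[OF linT] algebra_simps)

lemma poly_op_smult: "poly_op T (smult c p) v = c *\<^sub>R poly_op T p v"
  by (induct p) (auto simp: linear_cmul[OF linT] algebra_simps)

lemma poly_op_mult: "poly_op T (p * q) v = poly_op T p (poly_op T q v)"
  by (induct p) (auto simp: poly_op_add poly_op_smult)

lemma poly_op_monom: "poly_op T (monom c k) v = c *\<^sub>R (T ^^ k) v"
  by (induct k) (auto simp: monom_0 monom_Suc linear_cmul[OF linT] linear_0[OF linT])

lemma poly_op_sum: "poly_op T (sum f A) v = (\<Sum>i\<in>A. poly_op T (f i) v)"
  by (induct A rule: infinite_finite_induct) (auto simp: poly_op_add)

lemma poly_op_closed:
  assumes "subspace X" "T ` X \<subseteq> X" "v \<in> X"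
  shows "poly_op T p v \<in> X"
  using assms by (induct p) (auto simp: subspace_0 intro!: subspace_add subspace_mul)

end

lemma annihilating_poly:
  fixes T :: "'a::euclidean_space \<Rightarrow> 'a"
  assumes "linear T"
  obtains p where "p \<noteq> 0" "poly_op T p v = 0"
proof -
  let ?w = "\<lambda>k. (T ^^ k) v" and ?B = "{..DIM('a)}"
  have "\<not> (inj_on ?w ?B \<and> independent (?w ` ?B))"
  proof
    assume "inj_on ?w ?B \<and> independent (?w ` ?B)"
    then have "card ?B \<le> DIM('a)"
      using independent_bound[of "?w ` ?B"] card_image[of ?w ?B] by simp
    then show False by simp
  qed
  then have "\<not> (\<forall>c. (\<Sum>b\<in>?B. c b *\<^sub>R ?w b) = 0 \<longrightarrow> (\<forall>b\<in>?B. c b = 0))"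
    using independent_familyI[of ?B ?w] by blast
  then obtain c j where c: "(\<Sum>b\<in>?B. c b *\<^sub>R ?w b) = 0" and j: "j \<in> ?B" "c j \<noteq> 0" by blast
  define p where "p = (\<Sum>k\<in>?B. monom (c k) k)"
  have "coeff p j = c j" using j by (simp add: p_def coeff_sum if_distrib)
  then have "p \<noteq> 0" using j by auto
  moreover have "poly_op T p v = 0"
    using c by (simp add: p_def poly_op_sum[OF assms] poly_op_monom[OF assms])
  ultimately show thesis by (rule that)
qed

text \<open>
  A root in the complex numbers exists by the fundamental theorem of algebra. If it is not real,
  the remainder of \<open>p\<close> modulo the real quadratic with this root is a real linear polynomial with a
  nonreal root, hence zero.
\<close>
lemma real_poly_quadratic_factor:
  fixes p :: "real poly"
  assumes "degree p \<ge> 1"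
  obtains a b q where "p = [:-a, 1:] * q" | a b q where "p = [:a\<^sup>2 + b\<^sup>2, - 2 * a, 1:] * q"
proof -
  define ev where "ev z p = poly (map_poly complex_of_real p) z" for z p
  have ev0: "ev z 0 = 0" and evC: "ev z (pCons c p) = of_real c + z * ev z p" for z c p
    by (simp_all add: ev_def map_poly_pCons)
  have evA: "ev z (p + q) = ev z p + ev z q" for z p q
    by (induct p q rule: poly_induct2) (auto simp: ev0 evC algebra_simps)
  have evS: "ev z (smult c p) = of_real c * ev z p" for z c p
    by (induct p) (auto simp: ev0 evC algebra_simps)
  have evM: "ev z (p * q) = ev z p * ev z q" for z p q
    by (induct p) (auto simp: ev0 evC evA evS algebra_simps)
  have "degree (map_poly complex_of_real p) = degree p" by (simp add: degree_map_poly)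
  then have "\<not> constant (poly (map_poly complex_of_real p))" using assms by (simp add: constant_degree)
  then obtain z where z: "ev z p = 0" unfolding ev_def using fundamental_theorem_of_algebra by blast
  define a b where "a = Re z" and "b = Im z"
  have zab: "z = Complex a b" by (simp add: a_def b_def)
  show thesis
  proof (cases "b = 0")
    case True
    have "ev z p = of_real (poly p a)"
      using True by (induct p) (auto simp: ev0 evC zab complex_of_real_def[symmetric])
    then have "poly p a = 0" using z by simp
    then show thesis using that(1) by (auto simp: poly_eq_0_iff_dvd dvd_def)
  next
    case False
    let ?q = "[:a\<^sup>2 + b\<^sup>2, - 2 * a, 1:]"
    define r where "r = p mod ?q"
    have "ev z ?q = 0"
      by (simp add: evC ev0 zab complex_eq_iff power2_eq_square algebra_simps)
    moreover have "p = ?q * (p div ?q) + r" unfolding r_def by (rule mult_div_mod_eq[symmetric])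
    ultimately have rz: "ev z r = 0" using z by (metis add_0 evA evM mult_zero_left)
    have "r = 0 \<or> degree r < degree ?q" unfolding r_def by (rule degree_mod_less) simp
    then have "degree r \<le> 1" by auto
    then obtain c d where r: "r = [:c, d:]"
      by (metis degree_0 degree_pCons_eq_if le_zero_eq not_less_eq_eq pCons_cases One_nat_def
          degree_eq_zeroE pCons_0_0 Suc_le_mono)
    have "d = 0 \<and> c = 0" using rz False by (auto simp: r evC ev0 zab complex_eq_iff)
    then show thesis using that(2) \<open>p = _\<close> r by auto
  qed
qed

text \<open>
  Some nonzero polynomial annihilates a given vector. Splitting off linear and quadratic factors one
  by one, the first cofactor whose value on the vector is nonzero provides the new vector. Allowing
  \<open>b = 0\<close> puts real and complex eigenvalues into one formula.
\<close>
lemma quadratic_eigenvector: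
  fixes T :: "'a::euclidean_space \<Rightarrow> 'a"
  assumes linT: "linear T" and X: "subspace X" "T ` X \<subseteq> X" "X \<noteq> {0}"
  obtains a b v where "v \<in> X" "v \<noteq> 0"
    "T (T v) - (2 * a) *\<^sub>R T v + (a\<^sup>2 + b\<^sup>2) *\<^sub>R v = 0"
proof -
  obtain v where v: "v \<in> X" "v \<noteq> 0" using X subspace_0 by blast
  obtain p where p: "p \<noteq> 0" "poly_op T p v = 0" using annihilating_poly[OF linT] by blast
  have "\<exists>a b u. u \<in> X \<and> u \<noteq> 0 \<and> T (T u) - (2 * a) *\<^sub>R T u + (a\<^sup>2 + b\<^sup>2) *\<^sub>R u = 0"
    using p v
  proof (induct "degree p" arbitrary: p v rule: less_induct)
    case less
    have deg: "degree p \<ge> 1"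
    proof (rule ccontr)
      assume "\<not> degree p \<ge> 1"
      then obtain c where "p = [:c:]" by (metis degree_eq_zeroE less_one not_le)
      then show False using less.prems linear_0[OF linT] by (auto simp: poly_op_pCons[OF linT] poly_op_0[OF linT])
    qed
    from real_poly_quadratic_factor[OF deg]
    consider (lin) a q where "p = [:-a, 1:] * q" | (quad) a b q where "p = [:a\<^sup>2 + b\<^sup>2, - 2 * a, 1:] * q"
      by metis
    then show ?case
    proof cases
      case lin
      define u where "u = poly_op T q v"
      have q: "q \<noteq> 0" "degree q < degree p" using lin less.prems(1) by (auto simp: degree_mult_eq simp del: mult_pCons_left)
      have uX: "u \<in> X" unfolding u_def by (rule poly_op_closed[OF linT X(1,2)]) (rule less.prems)
      have "T u = a *\<^sub>R u"
        using less.prems(2) by (simp add: lin poly_op_mult[OF linT] poly_op_pCons[OF linT]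
            poly_op_0[OF linT] linear_0[OF linT] flip: u_def del: mult_pCons_left)
      then have "T (T u) - (2 * a) *\<^sub>R T u + (a\<^sup>2 + 0\<^sup>2) *\<^sub>R u = 0"
        by (simp add: linear_cmul[OF linT] power2_eq_square algebra_simps)
          (simp flip: scaleR_add_left)
      then show ?thesis using uX less.hyps[of q v] q less.prems u_def by blast
    next
      case quad
      define u where "u = poly_op T q v"
      have q: "q \<noteq> 0" "degree q < degree p" using quad less.prems(1) by (auto simp: degree_mult_eq simp del: mult_pCons_left)
      have uX: "u \<in> X" unfolding u_def by (rule poly_op_closed[OF linT X(1,2)]) (rule less.prems)
      have "T (T u) - (2 * a) *\<^sub>R T u + (a\<^sup>2 + b\<^sup>2) *\<^sub>R u = 0"
      proof -
        have "poly_op T p v = (a\<^sup>2 + b\<^sup>2) *\<^sub>R u + T ((- 2 * a) *\<^sub>R u + T u)"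
          by (simp add: quad poly_op_mult[OF linT] poly_op_pCons[OF linT]
              poly_op_0[OF linT] linear_0[OF linT] flip: u_def del: mult_pCons_left)
        also have "T ((- 2 * a) *\<^sub>R u + T u) = T (T u) - (2 * a) *\<^sub>R T u"
          by (simp add: linear_add[OF linT] linear_diff[OF linT] linear_cmul[OF linT])
        finally show ?thesis using less.prems(2) by (simp add: algebra_simps)
      qed
      then show ?thesis using uX less.hyps[of q v] q less.prems u_def by blast
    qed
  qed
  then show thesis using that by blast
qed

locale commuting_operators =
  fixes X :: "'a::euclidean_space set" and I :: "'i set" and T :: "'i \<Rightarrow> 'a \<Rightarrow> 'a"
  assumes X: "subspace X"
    and lin: "i \<in> I \<Longrightarrow> linear (T i)"
    and closed: "i \<in> I \<Longrightarrow> v \<in> X \<Longrightarrow> T i v \<in> X"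
    and comm: "i \<in> I \<Longrightarrow> j \<in> I \<Longrightarrow> v \<in> X \<Longrightarrow> T i (T j v) = T j (T i v)"
begin

definition invariant :: "'a set \<Rightarrow> bool" where
  "invariant Y \<longleftrightarrow> subspace Y \<and> Y \<subseteq> X \<and> (\<forall>i\<in>I. \<forall>v\<in>Y. T i v \<in> Y)"

text \<open>A vector that is cyclic for one operator determines every operator commuting with it.\<close>
lemma plane_commutant:
  assumes "dim X = 2" "I \<noteq> {}"
  obtains j where "j \<in> I" "\<And>i. i \<in> I \<Longrightarrow> \<exists>a b. \<forall>v\<in>X. T i v = a *\<^sub>R v + b *\<^sub>R T j v"
proof (cases "\<exists>j\<in>I. \<exists>v\<in>X. T j v \<notin> span {v}")
  case True
  then obtain j v where j: "j \<in> I" and v: "v \<in> X" "T j v \<notin> span {v}" by blast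
  have "v \<noteq> 0" using v(2) linear_0[OF lin[OF j]] by (auto simp: span_zero)
  then have spX: "\<exists>a b. u = a *\<^sub>R v + b *\<^sub>R T j v" if "u \<in> X" for u
    using plane_spanned[OF X assms(1) v(1) _ closed[OF j v(1)] v(2) that] by metis
  have "\<exists>a b. \<forall>u\<in>X. T i u = a *\<^sub>R u + b *\<^sub>R T j u" if i: "i \<in> I" for i
  proof -
    obtain a b where ab: "T i v = a *\<^sub>R v + b *\<^sub>R T j v" using spX[OF closed[OF i v(1)]] by blast
    have "T i u = a *\<^sub>R u + b *\<^sub>R T j u" if u0: "u \<in> X" for u
    proof -
      obtain c d where u: "u = c *\<^sub>R v + d *\<^sub>R T j v" using spX[OF u0] by blast
      have "T i (T j v) = T j (T i v)" by (rule comm[OF i j v(1)])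
      then show ?thesis
        by (simp add: u ab linear_add[OF lin[OF i]] linear_cmul[OF lin[OF i]]
            linear_add[OF lin[OF j]] linear_cmul[OF lin[OF j]] algebra_simps)
    qed
    then show ?thesis by blast
  qed
  with j show thesis by (rule that)
next
  case False
  then have sc: "\<exists>c. T i v = c *\<^sub>R v" if "i \<in> I" "v \<in> X" for i v
    using that by (auto simp: span_singleton)
  obtain j where j: "j \<in> I" using assms(2) by blast
  obtain B where B: "B \<subseteq> X" "independent B" "X \<subseteq> span B" "card B = 2"
    using basis_exists[of X] unfolding assms(1) .
  then obtain u v where uv: "B = {u, v}" "u \<noteq> v" by (auto simp: card_2_iff)
  have "\<exists>a b. \<forall>x\<in>X. T i x = a *\<^sub>R x + b *\<^sub>R T j x" if i: "i \<in> I" for i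
  proof -
    obtain a where a: "T i u = a *\<^sub>R u" using sc[OF i] B uv by blast
    obtain b where b: "T i v = b *\<^sub>R v" using sc[OF i] B uv by blast
    have "u + v \<in> X" using B uv X by (auto intro: subspace_add)
    then obtain c where "T i (u + v) = c *\<^sub>R (u + v)" using sc[OF i] by blast
    then have ac: "(a - c) *\<^sub>R u + (b - c) *\<^sub>R v = 0"
      by (simp add: a b linear_add[OF lin[OF i]] algebra_simps)
    let ?k = "\<lambda>x. if x = u then a - c else b - c"
    have "(\<Sum>x\<in>{u, v}. ?k x *\<^sub>R x) = 0" using uv ac by simp
    then have "?k x = 0" if "x \<in> {u, v}" for x
      using independentD[OF B(2), of "{u, v}" ?k x] uv(1) that by simp
    from this[of u] this[of v] have "a = c" "b = c" using uv(2) by simp_all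
    have "T i x = c *\<^sub>R x + 0 *\<^sub>R T j x" if "x \<in> X" for x
    proof -
      have "x \<in> span {u, v}" using that B uv by auto
      then show ?thesis
      proof (induct rule: span_induct_alt)
        case base then show ?case using linear_0[OF lin[OF i]] by simp
      next
        case (step k x y)
        then show ?case using a b \<open>a = c\<close> \<open>b = c\<close>
          by (auto simp: linear_add[OF lin[OF i]] linear_cmul[OF lin[OF i]] algebra_simps)
      qed
    qed
    then show ?thesis by blast
  qed
  with j show thesis by (rule that)
qed

end

text \<open>
  A commuting family in dimension at least three leaves a proper subspace of dimension two or more invariant,
  so this locale is inconsistent; it collects the hypotheses of the indirect proof.
\<close>
locale nearly_irreducible = commuting_operators X I T
  for X :: "'a::euclidean_space set" and I :: "'i set" and T :: "'i \<Rightarrow> 'a \<Rightarrow> 'a" +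
  assumes irr: "invariant Y \<Longrightarrow> dim Y \<le> 1 \<or> Y = X"
    and big: "dim X \<ge> 3"
begin

text \<open>
  An operator of the commutant with a nontrivial kernel is zero. Its kernel and its image are
  invariant; in dimension at least three they cannot both have dimension at most one, and the image
  cannot be everything.
\<close>
lemma commutant_zero_or_injective:
  assumes S: "linear S" "\<And>v. v \<in> X \<Longrightarrow> S v \<in> X"
    and SC: "\<And>i v. i \<in> I \<Longrightarrow> v \<in> X \<Longrightarrow> T i (S v) = S (T i v)"
    and v: "v \<in> X" "v \<noteq> 0" "S v = 0" and u: "u \<in> X"
  shows "S u = 0"
proof -
  let ?K = "{x \<in> X. S x = 0}"
  have K: "invariant ?K"
    using X closed SC linear_0[OF lin] unfolding invariant_def subspace_def
    by (auto simp: linear_0[OF S(1)] linear_add[OF S(1)] linear_cmul[OF S(1)]) (metis linear_0 lin)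
  have im: "invariant (S ` X)"
    using S SC closed unfolding invariant_def by (auto simp: linear_subspace_image X)
  have "dim ?K \<le> 1 \<or> ?K = X" by (rule irr[OF K])
  then show ?thesis
  proof
    assume K1: "dim ?K \<le> 1"
    have "dim (S ` X) \<le> 1 \<or> S ` X = X" by (rule irr[OF im])
    then show ?thesis
    proof
      assume "dim (S ` X) \<le> 1"
      moreover have "subspace (S ` X)" using im by (simp add: invariant_def)
      ultimately obtain w where w: "S ` X = span {w}" by (metis subspace_line)
      then obtain x where x: "x \<in> X" "S x = w" by (metis image_iff insertI1 span_base)
      have "X \<subseteq> span (insert x ?K)"
      proof
        fix y assume y: "y \<in> X"
        then have "S y \<in> span {w}" using w by blast
        then obtain c where "S y = c *\<^sub>R w" by (auto simp: span_singleton)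
        then have "y - c *\<^sub>R x \<in> ?K"
          using x y X by (auto simp: linear_diff[OF S(1)] linear_cmul[OF S(1)] intro!: subspace_diff subspace_mul)
        then show "y \<in> span (insert x ?K)" unfolding span_breakdown_eq by (blast intro: span_base)
      qed
      then have "dim X \<le> dim (insert x ?K)" using dim_subset[of X "span (insert x ?K)"] by (simp only: dim_span)
      also have "\<dots> \<le> dim ?K + 1" by (simp add: dim_insert)
      finally show ?thesis using K1 big by simp
    next
      assume onto: "S ` X = X"
      obtain B where B: "{v} \<subseteq> B" "B \<subseteq> X" "independent B" "X \<subseteq> span B"
        using maximal_independent_subset_extend[of "{v}" X] v by auto
      have finB: "finite B" using B(3) by (rule independent_imp_finite)
      have "S x \<in> span (S ` (B - {v}))" if "x \<in> B" for x
        using v(3) that by (cases "x = v") (auto simp: span_zero intro: span_base)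
      then have "S ` B \<subseteq> span (S ` (B - {v}))" by blast
      then have "span (S ` B) \<subseteq> span (S ` (B - {v}))" by (simp add: span_minimal)
      moreover have "S ` X \<subseteq> span (S ` B)"
        using B(4) by (simp add: linear_span_image[OF S(1)] image_mono)
      ultimately have "X \<subseteq> span (S ` (B - {v}))" using onto by blast
      then have "dim X \<le> card (S ` (B - {v}))" by (rule dim_le_card) (use finB in simp)
      also have "\<dots> \<le> card (B - {v})" by (rule card_image_le) (use finB in simp)
      also have "\<dots> < card B" using B(1) finB by (intro card_Diff1_less) auto
      also have "card B = dim X" using B(2-4) by (metis dim_unique)
      finally show ?thesis by simp
    qed
  qed (use u in auto)
qed

text \<open>
  The quadratic polynomial with a nontrivial kernel lies in the commutant, so it vanishes on all
  of \<open>X\<close>.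
\<close>
lemma quadratic_relation:
  assumes i: "i \<in> I"
  obtains a b where "\<And>v. v \<in> X \<Longrightarrow> T i (T i v) - (2 * a) *\<^sub>R T i v + (a\<^sup>2 + b\<^sup>2) *\<^sub>R v = 0"
proof -
  have "X \<noteq> {0}" using big by auto
  moreover have "T i ` X \<subseteq> X" using closed[OF i] by blast
  ultimately obtain a b v where v: "v \<in> X" "v \<noteq> 0"
    "T i (T i v) - (2 * a) *\<^sub>R T i v + (a\<^sup>2 + b\<^sup>2) *\<^sub>R v = 0"
    using quadratic_eigenvector[OF lin[OF i] X, of thesis] by metis
  let ?S = "\<lambda>v. T i (T i v) - (2 * a) *\<^sub>R T i v + (a\<^sup>2 + b\<^sup>2) *\<^sub>R v"
  have "?S u = 0" if u: "u \<in> X" for u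
  proof (rule commutant_zero_or_injective[where S = ?S and v = v])
    show "linear ?S"
      by (intro linearI) (simp_all add: linear_add[OF lin[OF i]] linear_cmul[OF lin[OF i]] algebra_simps)
    show "?S v \<in> X" if "v \<in> X" for v
      using that closed[OF i] X by (intro subspace_add subspace_diff subspace_mul) auto
    show "T j (?S v) = ?S (T j v)" if j: "j \<in> I" "v \<in> X" for j v
      using j comm[OF j(1) i] closed[OF i]
      by (simp add: linear_add[OF lin[OF j(1)]] linear_diff[OF lin[OF j(1)]] linear_cmul[OF lin[OF j(1)]])
  qed (use v u in auto)
  then show thesis by (rule that)
qed

text \<open>
  A nonscalar operator of the family has the form \<open>a + b J\<close> with \<open>J\<^sup>2 = -1\<close>; this is the
  operator \<open>J\<close>.
\<close>
definition unit_op :: "'i \<Rightarrow> real \<Rightarrow> real \<Rightarrow> 'a \<Rightarrow> 'a" where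
  "unit_op i a b v = (1 / b) *\<^sub>R (T i v - a *\<^sub>R v)"

lemma unit_op_linear: "i \<in> I \<Longrightarrow> linear (unit_op i a b)"
  unfolding unit_op_def
  by (intro linearI) (simp_all add: linear_add[OF lin] linear_cmul[OF lin] algebra_simps)

lemma unit_op_closed: "i \<in> I \<Longrightarrow> v \<in> X \<Longrightarrow> unit_op i a b v \<in> X"
  unfolding unit_op_def using closed X by (intro subspace_diff subspace_mul) auto

lemma unit_op_commute:
  assumes "i \<in> I" "j \<in> I" "v \<in> X"
  shows "T j (unit_op i a b v) = unit_op i a b (T j v)"
  using comm[OF assms] unfolding unit_op_def
  by (simp add: linear_diff[OF lin[OF assms(2)]] linear_cmul[OF lin[OF assms(2)]])

lemma unit_op_commute_unit_op:
  assumes "i \<in> I" "j \<in> I" "v \<in> X"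
  shows "unit_op j c d (unit_op i a b v) = unit_op i a b (unit_op j c d v)"
  unfolding unit_op_def[of j]
  by (simp add: unit_op_commute[OF assms] linear_diff[OF unit_op_linear[OF assms(1)]]
      linear_cmul[OF unit_op_linear[OF assms(1)]])

lemma scalar_or_complex:
  assumes i: "i \<in> I"
  obtains (scalar) a where "\<And>v. v \<in> X \<Longrightarrow> T i v = a *\<^sub>R v"
    | (complex) a b where "b \<noteq> 0" "\<And>v. v \<in> X \<Longrightarrow> unit_op i a b (unit_op i a b v) = - v"
proof -
  obtain a b where ab: "\<And>v. v \<in> X \<Longrightarrow> T i (T i v) - (2 * a) *\<^sub>R T i v + (a\<^sup>2 + b\<^sup>2) *\<^sub>R v = 0"
    using quadratic_relation[OF i] by blast
  note L = linear_diff[OF lin[OF i]] linear_cmul[OF lin[OF i]]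
  have sq: "unit_op i a c (unit_op i a c v) = (1 / c\<^sup>2) *\<^sub>R (- (b\<^sup>2) *\<^sub>R v)" if v: "v \<in> X" for c v
  proof -
    have "(2 * a) *\<^sub>R T i v = a *\<^sub>R T i v + a *\<^sub>R T i v" by (simp only: mult_2 scaleR_add_left)
    then have "T i (T i v) - a *\<^sub>R T i v - a *\<^sub>R (T i v - a *\<^sub>R v)
        = (T i (T i v) - (2 * a) *\<^sub>R T i v + (a\<^sup>2 + b\<^sup>2) *\<^sub>R v) - b\<^sup>2 *\<^sub>R v"
      by (simp add: scaleR_add_left scaleR_diff_right power2_eq_square)
    also have "\<dots> = - (b\<^sup>2) *\<^sub>R v" by (simp only: ab[OF v]) simp
    finally have "T i (T i v - a *\<^sub>R v) - a *\<^sub>R (T i v - a *\<^sub>R v) = - (b\<^sup>2) *\<^sub>R v"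
      by (simp only: L)
    moreover have "unit_op i a c (unit_op i a c v)
        = (1 / c\<^sup>2) *\<^sub>R (T i (T i v - a *\<^sub>R v) - a *\<^sub>R (T i v - a *\<^sub>R v))"
      by (simp add: unit_op_def L scaleR_diff_right power2_eq_square)
    ultimately show ?thesis by (simp only:)
  qed
  show thesis
  proof (cases "b = 0")
    case True
    have "X \<noteq> {0}" using big by auto
    then obtain v where v: "v \<in> X" "v \<noteq> 0" using X subspace_0 by blast
    let ?S = "unit_op i a 1"
    have SS: "?S (?S v) = 0" using sq[OF v(1)] True by simp
    have "?S u = 0" if u: "u \<in> X" for u
    proof (cases "?S v = 0")
      case True
      show ?thesis
        by (rule commutant_zero_or_injective[OF unit_op_linear[OF i] unit_op_closed[OF i]
              unit_op_commute[OF i] v True u])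
    next
      case False
      show ?thesis
        by (rule commutant_zero_or_injective[OF unit_op_linear[OF i] unit_op_closed[OF i]
              unit_op_commute[OF i] unit_op_closed[OF i v(1)] False SS u])
    qed
    then show thesis by (intro scalar[of a]) (simp add: unit_op_def)
  next
    case False
    then show thesis using sq[of _ b] by (intro complex[of b a]) auto
  qed
qed

text \<open>
  Two commuting complex units \<open>J\<close>, \<open>K\<close> satisfy \<open>(J - K)(J + K) = 0\<close>, so they agree up to sign.
  Hence one complex unit generates the whole family, and any of its complex lines is invariant.
\<close>
lemma nearly_irreducible_impossible: False
proof (cases "\<forall>i\<in>I. \<exists>a. \<forall>v\<in>X. T i v = a *\<^sub>R v")
  case True
  obtain B where B: "B \<subseteq> X" "independent B" "X \<subseteq> span B" "card B = dim X"
    by (rule basis_exists)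
  obtain C where C: "C \<subseteq> B" "card C = 2"
    by (rule obtain_subset_with_card_n[of 2 B]) (use big B in simp)
  have "independent C" using B(2) C(1) by (rule independent_mono)
  then have "dim (span C) = 2" using C(2) by (simp add: dim_eq_card_independent)
  moreover have "invariant (span C)"
    unfolding invariant_def
  proof (intro conjI ballI)
    show sC: "span C \<subseteq> X" using B(1) C(1) X by (intro span_minimal) auto
    fix i v assume "i \<in> I" and v: "v \<in> span C"
    then obtain a where "T i v = a *\<^sub>R v" using True sC by blast
    then show "T i v \<in> span C" using v by (simp add: span_mul)
  qed simp
  ultimately show False using irr[of "span C"] big by auto
next
  case False
  then obtain i where i: "i \<in> I" "\<nexists>a. \<forall>v\<in>X. T i v = a *\<^sub>R v" by blast
  obtain a b where b: "b \<noteq> 0" and JJ: "\<And>v. v \<in> X \<Longrightarrow> unit_op i a b (unit_op i a b v) = - v"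
    using scalar_or_complex[OF i(1)] i(2) by metis
  let ?J = "unit_op i a b"
  note lJ = unit_op_linear[OF i(1), of a b]
  note cJ = unit_op_closed[OF i(1), of _ a b]
  have gen: "\<exists>c d. \<forall>v\<in>X. T k v = c *\<^sub>R v + d *\<^sub>R ?J v" if k: "k \<in> I" for k
  proof (rule scalar_or_complex[OF k])
    fix c assume "\<And>v. v \<in> X \<Longrightarrow> T k v = c *\<^sub>R v"
    then have "\<forall>v\<in>X. T k v = c *\<^sub>R v + 0 *\<^sub>R ?J v" by simp
    then show ?thesis by blast
  next
    fix c d assume d: "d \<noteq> 0" and KK: "\<And>v. v \<in> X \<Longrightarrow> unit_op k c d (unit_op k c d v) = - v"
    let ?K = "unit_op k c d"
    note lK = unit_op_linear[OF k, of c d]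
    note cK = unit_op_closed[OF k, of _ c d]
    have TK: "T k v = c *\<^sub>R v + d *\<^sub>R ?K v" for v using d by (simp add: unit_op_def)
    \<comment> \<open>The factors \<open>J + K\<close> and \<open>J - K\<close> are the cases \<open>s = 1\<close> and \<open>s = -1\<close>.\<close>
    let ?S = "\<lambda>s v. ?J v + s *\<^sub>R ?K v"
    have lS: "linear (?S s)" for s
      by (intro linearI) (simp_all add: linear_add[OF lJ] linear_add[OF lK] linear_cmul[OF lJ]
          linear_cmul[OF lK] algebra_simps)
    have cS: "?S s v \<in> X" if "v \<in> X" for s v
      using cJ cK X that by (auto intro: subspace_add subspace_mul)
    have mS: "T j (?S s v) = ?S s (T j v)" if "j \<in> I" "v \<in> X" for s j v
      using that unit_op_commute[OF i(1)] unit_op_commute[OF k]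
      by (simp add: linear_add[OF lin] linear_cmul[OF lin])
    have "X \<noteq> {0}" using big by auto
    then obtain v where v: "v \<in> X" "v \<noteq> 0" using X subspace_0 by blast
    have prod: "?S (-1) (?S 1 v) = 0"
      using JJ[OF v(1)] KK[OF v(1)] unit_op_commute_unit_op[OF i(1) k v(1)]
      by (simp add: linear_add[OF lJ] linear_add[OF lK])
    have "\<exists>s. \<forall>u\<in>X. ?S s u = 0 \<and> (s = 1 \<or> s = -1)"
    proof (cases "?S 1 v = 0")
      case True
      then have "?S 1 u = 0" if "u \<in> X" for u
        using commutant_zero_or_injective[OF lS cS mS v True that] by simp
      then show ?thesis by blast
    next
      case False
      then have "?S (-1) u = 0" if "u \<in> X" for u
        using commutant_zero_or_injective[OF lS cS mS cS[OF v(1)] False prod that] by simp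
      then show ?thesis by blast
    qed
    then obtain s where s: "\<And>u. u \<in> X \<Longrightarrow> ?S s u = 0 \<and> (s = 1 \<or> s = -1)" by blast
    have "T k u = c *\<^sub>R u + (- s * d) *\<^sub>R ?J u" if "u \<in> X" for u
      using s[OF that] TK[of u] by (auto simp: add_eq_0_iff)
    then show ?thesis by blast
  qed
  have "X \<noteq> {0}" using big by auto
  then obtain v where v: "v \<in> X" "v \<noteq> 0" using X subspace_0 by blast
  let ?Y = "span {v, ?J v}"
  have YX: "?Y \<subseteq> X" using v cJ X by (intro span_minimal) auto
  have JY: "?J u \<in> ?Y" if "u \<in> ?Y" for u
    using that
  proof (induct rule: span_induct_alt)
    case base then show ?case by (simp add: linear_0[OF lJ] span_zero)
  next
    case (step c x y)
    have "- v \<in> ?Y" by (intro span_neg span_base) simp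
    then have "?J x \<in> ?Y" using step(1) JJ[OF v(1)] by (auto intro: span_base)
    then show ?case using step by (simp add: linear_add[OF lJ] linear_cmul[OF lJ] span_add span_mul)
  qed
  have "invariant ?Y"
    unfolding invariant_def
  proof (intro conjI ballI YX)
    fix k u assume k: "k \<in> I" and u: "u \<in> ?Y"
    obtain c d where "T k u = c *\<^sub>R u + d *\<^sub>R ?J u" using gen[OF k] u YX by blast
    then show "T k u \<in> ?Y" using u JY[OF u] by (simp add: span_add span_mul)
  qed simp
  moreover have "dim ?Y \<le> 2"
  proof -
    have "dim ?Y \<le> card {v, ?J v}" by (rule dim_le_card) auto
    also have "\<dots> \<le> 2" by (simp add: card_insert_if)
    finally show ?thesis .
  qed
  ultimately have "dim ?Y \<le> 1" using irr[of ?Y] big by auto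
  then have "?Y = span {v}" using v by (intro subspace_line_eq_span) (auto intro: span_base)
  moreover have "?J v \<in> ?Y" by (simp add: span_base)
  ultimately obtain c where c: "?J v = c *\<^sub>R v" by (auto simp: span_singleton)
  then have "?J (?J v) = (c * c) *\<^sub>R v" by (simp add: linear_cmul[OF lJ])
  then have "(c * c) *\<^sub>R v = - v" using JJ[OF v(1)] by simp
  then have "(c * c + 1) *\<^sub>R v = 0" by (simp add: scaleR_add_left)
  moreover have "c * c + 1 > 0" by (intro add_nonneg_pos) simp_all
  ultimately show False using v(2) by simp
qed

end

lemma (in commuting_operators) dim_le_2:
  assumes "\<And>Y. invariant Y \<Longrightarrow> dim Y \<le> 1 \<or> Y = X"
  shows "dim X \<le> 2"
proof (rule ccontr)
  assume d: "\<not> dim X \<le> 2"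
  have "nearly_irreducible X I T"
  proof (intro nearly_irreducible.intro nearly_irreducible_axioms.intro commuting_operators_axioms)
    show "dim Y \<le> 1 \<or> Y = X" if "invariant Y" for Y by (rule assms[OF that])
    show "3 \<le> dim X" using d by simp
  qed
  then show False by (rule nearly_irreducible.nearly_irreducible_impossible)
qed

section \<open>The exponential of the adjoint representation\<close>

context
  fixes D :: "'a::euclidean_space \<Rightarrow> 'a"
  assumes linD: "linear D"
begin

text \<open>The one-parameter group \<open>exp (t D)\<close>.\<close>
definition flow :: "real \<Rightarrow> 'a \<Rightarrow> 'a" where
  "flow t y = (\<Sum>k. (t ^ k / fact k) *\<^sub>R (D ^^ k) y)"

lemma bounded_linear_D: "bounded_linear D"
  using linD by (simp add: linear_conv_bounded_linear)

lemma norm_power_le: "norm ((D ^^ k) y) \<le> onorm D ^ k * norm y"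
proof (induct k)
  case (Suc k)
  have "norm (D ((D ^^ k) y)) \<le> onorm D * norm ((D ^^ k) y)"
    by (rule onorm[OF bounded_linear_D])
  also have "\<dots> \<le> onorm D * (onorm D ^ k * norm y)"
    by (rule mult_left_mono[OF Suc onorm_pos_le[OF bounded_linear_D]])
  finally show ?case by simp
qed simp

lemma summable_flow: "summable (\<lambda>k. (t ^ k / fact k) *\<^sub>R (D ^^ k) y)"
proof (rule summable_comparison_test)
  have "norm ((t ^ k / fact k) *\<^sub>R (D ^^ k) y) \<le> inverse (fact k) * (\<bar>t\<bar> * onorm D) ^ k * norm y" for k
  proof -
    have "norm ((t ^ k / fact k) *\<^sub>R (D ^^ k) y) = \<bar>t\<bar> ^ k / fact k * norm ((D ^^ k) y)"
      by (simp add: power_abs)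
    also have "\<dots> \<le> \<bar>t\<bar> ^ k / fact k * (onorm D ^ k * norm y)"
      by (rule mult_left_mono[OF norm_power_le]) simp
    finally show ?thesis by (simp add: power_mult_distrib field_simps)
  qed
  then show "\<exists>N. \<forall>k\<ge>N. norm ((t ^ k / fact k) *\<^sub>R (D ^^ k) y)
      \<le> inverse (fact k) * (\<bar>t\<bar> * onorm D) ^ k * norm y" by blast
  show "summable (\<lambda>k. inverse (fact k) * (\<bar>t\<bar> * onorm D) ^ k * norm y)"
    by (intro summable_mult2 summable_exp)
qed

lemma linear_flow: "linear (flow t)"
proof (rule linearI)
  have lin: "linear (D ^^ k)" for k
  proof (induct k)
    case 0 show ?case by (simp add: linear_id[unfolded id_def])
  next
    case (Suc k) then show ?case using linear_compose[OF Suc linD] by (simp add: o_def)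
  qed
  show "flow t (x + y) = flow t x + flow t y" for x y
    unfolding flow_def suminf_add[OF summable_flow summable_flow]
    by (simp add: linear_add[OF lin] scaleR_add_right)
  show "flow t (c *\<^sub>R x) = c *\<^sub>R flow t x" for c x
    unfolding flow_def suminf_scaleR_right[OF summable_flow]
    by (simp add: linear_cmul[OF lin] mult.commute)
qed

lemma D_flow: "D (flow t y) = flow t (D y)"
proof -
  have "D (flow t y) = (\<Sum>k. D ((t ^ k / fact k) *\<^sub>R (D ^^ k) y))"
    unfolding flow_def by (rule bounded_linear.suminf[OF bounded_linear_D summable_flow])
  also have "\<dots> = flow t (D y)"
    unfolding flow_def by (simp add: linear_cmul[OF linD] funpow_swap1)
  finally show ?thesis .
qed

lemma flow_0 [simp]: "flow 0 y = y"
proof -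
  have "(\<lambda>k. (0 ^ k / fact k) *\<^sub>R (D ^^ k) y) sums (\<Sum>k\<in>{0}. (0 ^ k / fact k) *\<^sub>R (D ^^ k) y)"
    by (rule sums_finite) auto
  then show ?thesis unfolding flow_def by (simp add: sums_iff)
qed

text \<open>
  Each coordinate is a real power series in \<open>t\<close>, which may be differentiated termwise.
\<close>
lemma flow_has_vector_derivative:
  "((\<lambda>t. flow t y) has_vector_derivative D (flow t y)) (at t)"
proof -
  have inner: "flow s z \<bullet> b = (\<Sum>k. ((D ^^ k) z \<bullet> b / fact k) * s ^ k)" for s z b
  proof -
    have "flow s z \<bullet> b = (\<Sum>k. ((s ^ k / fact k) *\<^sub>R (D ^^ k) z) \<bullet> b)"
      unfolding flow_def
      by (rule bounded_linear.suminf[OF bounded_linear_inner_left summable_flow])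
    then show ?thesis by (simp add: mult.commute)
  qed
  have "((\<lambda>t. flow t y \<bullet> b) has_field_derivative (D (flow t y) \<bullet> b)) (at t)" for b
  proof -
    let ?c = "\<lambda>k. (D ^^ k) y \<bullet> b / fact k"
    have "summable (\<lambda>k. ?c k * s ^ k)" for s
    proof -
      have "summable (\<lambda>k. ((s ^ k / fact k) *\<^sub>R (D ^^ k) y) \<bullet> b)"
        by (rule bounded_linear.summable[OF bounded_linear_inner_left summable_flow])
      then show ?thesis by (simp add: mult.commute)
    qed
    then have "((\<lambda>t. \<Sum>k. ?c k * t ^ k) has_field_derivative (\<Sum>k. diffs ?c k * t ^ k)) (at t)"
      by (rule termdiffs_strong_converges_everywhere)
    moreover have "diffs ?c k = (D ^^ k) (D y) \<bullet> b / fact k" for k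
      by (simp add: diffs_def funpow_swap1 field_simps del: of_nat_Suc)
    ultimately show ?thesis unfolding inner D_flow by simp
  qed
  then show ?thesis
    unfolding has_vector_derivative_def has_field_derivative_def
    by (subst has_derivative_componentwise_within) (simp add: mult_commute_abs)
qed

text \<open>
  A solution starting at zero stays zero: by Cauchy-Schwarz its squared length times
  \<open>exp (- 2 K t)\<close> is nonincreasing when \<open>K\<close> bounds the operator.
\<close>
lemma ode_zero:
  assumes "\<And>t. (u has_vector_derivative D (u t)) (at t)" "u 0 = 0" "t \<ge> (0::real)"
  shows "u t = 0"
proof -
  let ?K = "onorm D"
  let ?g = "\<lambda>t. exp (- 2 * ?K * t) * (u t \<bullet> u t)"
  have "\<exists>y. (?g has_real_derivative y) (at s) \<and> y \<le> 0" for s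
  proof -
    have ud: "(u has_derivative (\<lambda>h. h *\<^sub>R D (u s))) (at s)"
      using assms(1)[of s] by (simp add: has_vector_derivative_def)
    have "((\<lambda>t. u t \<bullet> u t) has_real_derivative (2 * (u s \<bullet> D (u s)))) (at s)"
      unfolding has_field_derivative_def
      by (rule has_derivative_eq_rhs[OF has_derivative_inner[OF ud ud]])
         (auto simp: inner_commute algebra_simps)
    then have "(?g has_real_derivative
        (exp (- 2 * ?K * s) * (2 * (u s \<bullet> D (u s)) - 2 * ?K * (u s \<bullet> u s)))) (at s)"
      by (auto intro!: derivative_eq_intros simp: algebra_simps)
    moreover have "u s \<bullet> D (u s) \<le> ?K * (u s \<bullet> u s)"
    proof -
      have "u s \<bullet> D (u s) \<le> norm (u s) * norm (D (u s))" by (rule norm_cauchy_schwarz)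
      also have "\<dots> \<le> norm (u s) * (?K * norm (u s))"
        by (intro mult_left_mono onorm[OF bounded_linear_D]) simp
      finally show ?thesis by (simp add: dot_square_norm power2_eq_square algebra_simps)
    qed
    ultimately show ?thesis by (intro exI conjI) (auto simp: mult_le_0_iff)
  qed
  then have "?g t \<le> ?g 0" by (intro DERIV_nonpos_imp_nonincreasing[OF assms(3)]) blast
  then have "u t \<bullet> u t \<le> 0" using assms(2) by (simp add: mult_le_0_iff)
  then show ?thesis by (metis inner_ge_zero inner_eq_zero_iff order_antisym)
qed

lemma ode_unique:
  assumes u: "\<And>t. (u has_vector_derivative D (u t)) (at t)" and "t \<ge> (0::real)"
  shows "u t = flow t (u 0)"
proof -
  have "((\<lambda>t. u t - flow t (u 0)) has_vector_derivative D (u s - flow s (u 0))) (at s)" for s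
    unfolding linear_diff[OF linD]
    by (intro has_vector_derivative_diff u flow_has_vector_derivative)
  from ode_zero[OF this _ assms(2)] show ?thesis by simp
qed

lemma flow_add: "t \<ge> 0 \<Longrightarrow> flow (t + s) y = flow t (flow s y)"
proof -
  assume t: "t \<ge> 0"
  have "((\<lambda>t. flow (t + s) y) has_vector_derivative D (flow (r + s) y)) (at r)" for r
  proof -
    have "((\<lambda>t. t + s) has_vector_derivative 1) (at r)"
      by (auto intro!: derivative_eq_intros)
    from vector_diff_chain_at[OF this flow_has_vector_derivative[of y "r + s"]]
    show ?thesis by (simp add: o_def)
  qed
  from ode_unique[of "\<lambda>t. flow (t + s) y", OF this t] show ?thesis by simp
qed

end

context real_lie_algebra
begin

lemmas br_simps = bilinear_ladd[OF bilinear_br] bilinear_radd[OF bilinear_br]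
  bilinear_lmul[OF bilinear_br] bilinear_rmul[OF bilinear_br] bilinear_lzero[OF bilinear_br]
  bilinear_rzero[OF bilinear_br] bilinear_lsub[OF bilinear_br] bilinear_rsub[OF bilinear_br]
  bilinear_lneg[OF bilinear_br] bilinear_rneg[OF bilinear_br]

lemma linear_br: "linear (br x)" and linear_br_left: "linear (\<lambda>x. br x y)"
  using bilinear_br by (auto simp: bilinear_def)

lemma br_anti: "br x y = - br y x"
proof -
  have "br (x + y) (x + y) = 0" by (rule br_self)
  then have "br x y + br y x = 0"
    using bilinear_ladd[OF bilinear_br, of x y "x + y"] bilinear_radd[OF bilinear_br, of _ x y]
    by (simp add: br_self)
  then show ?thesis by (simp add: eq_neg_iff_add_eq_0)
qed

lemma br_derivation: "br x (br y z) = br (br x y) z + br y (br x z)"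
  using jacobi[of x y z] br_anti[of z "br x y"] br_anti[of z x] by (simp add: br_simps algebra_simps)

lemma exp_ad_scaled: "exp_ad br (t *\<^sub>R x) y = flow (br x) t y"
proof -
  have "((br (t *\<^sub>R x)) ^^ k) y = t ^ k *\<^sub>R ((br x) ^^ k) y" for k
    by (induct k) (simp_all add: br_simps)
  then show ?thesis by (simp add: exp_ad_def flow_def[OF linear_br] mult.commute)
qed

lemma exp_ad_flow: "exp_ad br x y = flow (br x) 1 y"
  using exp_ad_scaled[of 1 x y] by simp

lemma flow_minus: "flow (br (- x)) t y = flow (br x) (- t) y"
  using exp_ad_scaled[of "- t" x y] exp_ad_scaled[of t "- x" y] by simp

lemma flow_inverse: "flow (br x) (- t) (flow (br x) t y) = y"
proof (cases "t \<ge> 0")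
  case True
  have "flow (br (-x)) (t + (- t)) y = flow (br (-x)) t (flow (br (-x)) (-t) y)"
    by (rule flow_add[OF linear_br True])
  then show ?thesis by (simp add: flow_minus flow_0[OF linear_br])
next
  case False
  then have "flow (br x) (- t + t) y = flow (br x) (- t) (flow (br x) t y)"
    by (intro flow_add[OF linear_br]) simp
  then show ?thesis by (simp add: flow_0[OF linear_br])
qed

text \<open>
  Both sides solve the equation \<open>u' = [x, u]\<close> with the same initial value: for the right-hand side
  this is the Jacobi identity.
\<close>
lemma flow_br:
  assumes "t \<ge> 0"
  shows "flow (br x) t (br y z) = br (flow (br x) t y) (flow (br x) t z)"
proof -
  let ?u = "\<lambda>t. br (flow (br x) t y) (flow (br x) t z)"
  have bb: "bounded_bilinear br" using bilinear_br by (simp add: bilinear_conv_bounded_bilinear)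
  have "(?u has_vector_derivative br x (?u s)) (at s)" for s
    using bounded_bilinear.has_vector_derivative[OF bb flow_has_vector_derivative[OF linear_br, of x y s]
        flow_has_vector_derivative[OF linear_br, of x z s]]
    by (simp add: br_derivation[of x] add.commute)
  from ode_unique[OF linear_br this assms] show ?thesis by (simp add: flow_0[OF linear_br])
qed

lemma inv_flow: "inv (flow (br x) t) = flow (br x) (- t)"
proof (rule inv_equality)
  show "flow (br x) (- t) (flow (br x) t y) = y" for y by (rule flow_inverse)
  show "flow (br x) t (flow (br x) (- t) y) = y" for y
    using flow_inverse[of x "- t" y] by simp
qed

lemma Ad_group_automorphism:
  assumes "A \<in> Ad_group br"
  shows "linear A \<and> bij A \<and> (\<forall>y z. A (br y z) = br (A y) (A z))"
  using assms
proof induct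
  case Ad_one show ?case by (simp add: linear_id[unfolded id_def] bij_id[unfolded id_def])
next
  case (Ad_mult A x)
  have e: "exp_ad br x = flow (br x) 1" by (rule ext) (rule exp_ad_flow)
  have "bij (flow (br x) 1)"
    by (rule o_bij[of "flow (br x) (-1)"])
       (use flow_inverse[of x 1] flow_inverse[of x "-1"] in \<open>auto simp: fun_eq_iff\<close>)
  then show ?case
    using Ad_mult flow_br[of 1 x] linear_compose[OF _ linear_flow[OF linear_br], of A x 1]
      bij_comp[of A "flow (br x) 1"]
    by (simp add: e o_def)
qed

section \<open>Orbit dimensions are ranks\<close>

definition radical :: "('a \<Rightarrow> real) \<Rightarrow> 'a set" where
  "radical f = {x. \<forall>y. f (br x y) = 0}"

lemma coadjoint_apply:
  assumes "linear A" "bij A"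
  shows "blinfun_apply (coadjoint A F) y = blinfun_apply F (inv A y)"
proof -
  have "linear (inv A)" using assms by (intro inj_linear_imp_inv_linear) (auto simp: bij_is_inj)
  then have "linear (\<lambda>y. blinfun_apply F (inv A y))"
    using linear_compose[of "inv A" "blinfun_apply F"] 
    by (simp add: o_def bounded_linear.linear blinfun.bounded_linear_right)
  then show ?thesis by (simp add: coadjoint_def bounded_linear_Blinfun_apply linear_conv_bounded_linear)
qed

text \<open>
  If \<open>exp (t x)\<close> fixes \<open>F\<close> for all \<open>t\<close>, the derivative at \<open>t = 0\<close> of \<open>F (exp (t ad x) y)\<close> gives
  \<open>F [x, y] = 0\<close>; conversely, then all terms of positive degree of the exponential series vanish
  under \<open>F\<close>.
\<close>
lemma stabilizer_lie_eq_radical: "stabilizer_lie br F = radical (blinfun_apply F)"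
proof (intro set_eqI iffI)
  fix x
  have e: "exp_ad br (t *\<^sub>R x) = flow (br x) t" for t by (rule ext) (rule exp_ad_scaled)
  have bij: "bij (flow (br x) t)" for t
    by (rule o_bij[of "flow (br x) (-t)"])
       (use flow_inverse[of x t] flow_inverse[of x "-t"] in \<open>auto simp: fun_eq_iff\<close>)
  have st: "x \<in> stabilizer_lie br F \<longleftrightarrow> (\<forall>t y. blinfun_apply F (flow (br x) (- t) y) = blinfun_apply F y)"
    by (simp add: stabilizer_lie_def e blinfun_apply_inject[symmetric] fun_eq_iff inv_flow
        coadjoint_apply[OF linear_flow[OF linear_br] bij])
  have blF: "bounded_linear (blinfun_apply F)" by (rule blinfun.bounded_linear_right)
  {
    assume "x \<in> stabilizer_lie br F"
    then have c: "blinfun_apply F (flow (br x) t y) = blinfun_apply F y" for t y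
      using st by (metis minus_minus)
    show "x \<in> radical (blinfun_apply F)"
      unfolding radical_def
    proof (clarify)
      fix y
      have "((\<lambda>t. blinfun_apply F (flow (br x) t y)) has_vector_derivative blinfun_apply F (br x (flow (br x) 0 y))) (at 0)"
        by (rule bounded_linear.has_vector_derivative[OF blF flow_has_vector_derivative[OF linear_br]])
      then have "((\<lambda>t::real. blinfun_apply F y) has_vector_derivative blinfun_apply F (br x y)) (at 0)"
        by (simp add: c flow_0[OF linear_br])
      then show "blinfun_apply F (br x y) = 0"
        by (rule vector_derivative_unique_at) (rule has_vector_derivative_const)
    qed
  next
    assume "x \<in> radical (blinfun_apply F)"
    then have r: "blinfun_apply F (br x y) = 0" for y by (simp add: radical_def)
    have "blinfun_apply F (flow (br x) t y) = blinfun_apply F y" for t y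
    proof -
      have "blinfun_apply F (flow (br x) t y)
          = (\<Sum>k. blinfun_apply F ((t ^ k / fact k) *\<^sub>R ((br x) ^^ k) y))"
        unfolding flow_def[OF linear_br]
        by (rule bounded_linear.suminf[OF blF summable_flow[OF linear_br]])
      also have "\<dots> = (\<Sum>k. if k = 0 then blinfun_apply F y else 0)"
      proof (rule suminf_cong)
        show "blinfun_apply F ((t ^ k / fact k) *\<^sub>R ((br x) ^^ k) y)
            = (if k = 0 then blinfun_apply F y else 0)" for k
          by (cases k) (auto simp: blinfun.scaleR_right r)
      qed
      also have "\<dots> = blinfun_apply F y"
        using sums_single[of 0 "\<lambda>_. blinfun_apply F y"] by (simp add: sums_iff)
      finally show ?thesis .
    qed
    then show "x \<in> stabilizer_lie br F" by (simp add: st)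
  }
qed

text \<open>
  The operators \<open>Ad g\<close> are automorphisms, so they carry the form of \<open>F\<close> to the form of its translate.
\<close>
lemma radical_coadjoint:
  assumes "A \<in> Ad_group br"
  shows "radical (blinfun_apply (coadjoint A F)) = A ` radical (blinfun_apply F)"
proof -
  have A: "linear A" "bij A" "\<And>y z. A (br y z) = br (A y) (A z)"
    using Ad_group_automorphism[OF assms] by auto
  have i: "inv A (br (A x) (A y)) = br x y" for x y
    using A by (metis bij_inv_eq_iff)
  show ?thesis
  proof (intro set_eqI iffI)
    fix x assume x: "x \<in> radical (blinfun_apply (coadjoint A F))"
    obtain u where u: "x = A u" using A(2) by (metis bij_pointE)
    have "blinfun_apply F (inv A (br (A u) (A y))) = 0" for y
      using x by (simp add: radical_def coadjoint_apply[OF A(1,2)] u)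
    then show "x \<in> A ` radical (blinfun_apply F)" using u by (auto simp: radical_def i)
  next
    fix x assume "x \<in> A ` radical (blinfun_apply F)"
    then obtain u where u: "x = A u" "u \<in> radical (blinfun_apply F)" by blast
    have "blinfun_apply F (inv A (br (A u) y)) = 0" for y
      using i[of u "inv A y"] u(2) A(2) by (simp add: radical_def bij_is_surj surj_f_inv_f)
    then show "x \<in> radical (blinfun_apply (coadjoint A F))"
      by (simp add: radical_def coadjoint_apply[OF A(1,2)] u)
  qed
qed

text \<open>
  Along an orbit the radicals are moved by isomorphisms, so their common dimension makes the
  description that defines \<open>orbit_dim\<close> unambiguous.
\<close>
lemma orbit_dim_eq_rank:
  "orbit_dim br (coadjoint_orbit br F) + dim (radical (blinfun_apply F)) = DIM('a)"
proof -
  have d: "dim (stabilizer_lie br F') = dim (radical (blinfun_apply F))"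
    if F': "F' \<in> coadjoint_orbit br F" for F'
  proof -
    obtain A where A: "A \<in> Ad_group br" "F' = coadjoint A F" using F' by (auto simp: coadjoint_orbit_def)
    have "linear A" "inj A" using Ad_group_automorphism[OF A(1)] by (auto simp: bij_is_inj)
    then have "dim (A ` radical (blinfun_apply F)) = dim (radical (blinfun_apply F))"
      by (intro dim_image_eq) (auto intro: inj_on_subset)
    then show ?thesis by (simp add: stabilizer_lie_eq_radical A(2) radical_coadjoint[OF A(1)])
  qed
  have "coadjoint id F = F"
    by (simp add: coadjoint_def blinfun_apply_inverse)
  then have "F \<in> coadjoint_orbit br F"
    unfolding coadjoint_orbit_def using Ad_one[of br] by force
  have le: "dim (radical (blinfun_apply F)) \<le> DIM('a)" by (rule dim_subset_UNIV)
  have "orbit_dim br (coadjoint_orbit br F) = DIM('a) - dim (radical (blinfun_apply F))"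
    unfolding orbit_dim_def
  proof (rule the_equality)
    show "\<forall>F'\<in>coadjoint_orbit br F. DIM('a) - dim (radical (blinfun_apply F)) + dim (stabilizer_lie br F') = DIM('a)"
      using d le by simp
    show "k = DIM('a) - dim (radical (blinfun_apply F))"
      if "\<forall>F'\<in>coadjoint_orbit br F. k + dim (stabilizer_lie br F') = DIM('a)" for k
      using that d \<open>F \<in> coadjoint_orbit br F\<close> by fastforce
  qed
  then show ?thesis using le by simp
qed

end

section \<open>Lie algebras with line radicals\<close>

locale line_radical_algebra = real_lie_algebra br
  for br :: "'a::euclidean_space \<Rightarrow> 'a \<Rightarrow> 'a" +
  assumes solvable: "solvable_lie br"
    and noncommutative: "\<exists>u v. br u v \<noteq> 0"
    and line_radical: "linear f \<Longrightarrow> f (br u v) \<noteq> 0 \<Longrightarrow> dim (radical f) = 1"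
    and dim_ge_4: "DIM('a) \<ge> 4"
begin

definition derived :: "'a set" where
  "derived = span {br u v | u v. True}"

definition derived2 :: "'a set" where
  "derived2 = span {br u v | u v. u \<in> derived \<and> v \<in> derived}"

lemma subspace_derived: "subspace derived" and subspace_derived2: "subspace derived2"
  by (simp_all add: derived_def derived2_def)

lemma br_in_derived: "br u v \<in> derived"
  unfolding derived_def by (rule span_base) blast

lemma br_in_derived2: "u \<in> derived \<Longrightarrow> v \<in> derived \<Longrightarrow> br u v \<in> derived2"
  unfolding derived2_def by (rule span_base) blast

lemma derived_subset: "subspace U \<Longrightarrow> (\<And>u v. br u v \<in> U) \<Longrightarrow> derived \<subseteq> U"
  unfolding derived_def by (rule span_minimal) auto

lemma derived2_subset:
  "subspace U \<Longrightarrow> (\<And>u v. u \<in> derived \<Longrightarrow> v \<in> derived \<Longrightarrow> br u v \<in> U) \<Longrightarrow> derived2 \<subseteq> U"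
  unfolding derived2_def by (rule span_minimal) auto

lemma derived2_subset_derived: "derived2 \<subseteq> derived"
  by (rule derived2_subset[OF subspace_derived]) (rule br_in_derived)

lemma br_derived2: assumes "v \<in> derived2" shows "br x v \<in> derived2"
proof -
  have "derived2 \<subseteq> {v. br x v \<in> derived2}"
  proof (rule derived2_subset)
    show "subspace {v. br x v \<in> derived2}"
      using subspace_derived2 by (auto simp: subspace_def br_simps)
    show "br u v \<in> {v. br x v \<in> derived2}" if "u \<in> derived" "v \<in> derived" for u v
      using that subspace_derived2 br_in_derived2 br_in_derived
      by (auto simp: br_derivation[of x] intro: subspace_add)
  qed
  then show ?thesis using assms by blast
qed

lemma ideal_derived2: "lie_ideal br derived2"
  by (simp add: lie_ideal_def subspace_derived2 br_derived2)

text \<open>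
  A functional that vanishes on the ideal but not on the derived algebra has the whole ideal in
  its radical, which is a line.
\<close>
lemma ideal_dichotomy:
  assumes "lie_ideal br I"
  shows "dim I \<le> 1 \<or> derived \<subseteq> I"
proof (rule disjCI)
  have sub: "subspace I" and id: "\<And>x y. y \<in> I \<Longrightarrow> br x y \<in> I"
    using assms by (auto simp: lie_ideal_def)
  assume "\<not> derived \<subseteq> I"
  then obtain u v where "br u v \<notin> I" using derived_subset[OF sub] by blast
  then obtain f where f: "linear f" "\<And>x. x \<in> I \<Longrightarrow> f x = 0" "f (br u v) = (1::real)"
    using functional_separating_subspace[OF sub] by metis
  have "I \<subseteq> radical f"
  proof
    fix x assume x: "x \<in> I"
    have "br x y \<in> I" for y using id[OF x, of y] sub br_anti[of x y] by (simp add: subspace_neg)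
    then show "x \<in> radical f" using f(2) by (simp add: radical_def)
  qed
  then have "dim I \<le> dim (radical f)" by (rule dim_subset)
  then show "dim I \<le> 1" using line_radical[OF f(1), of u v] f(3) by simp
qed

text \<open>
  Otherwise the derived series would be constant from its first step on.
\<close>
lemma derived_ne_derived2: "\<not> derived \<subseteq> derived2"
proof
  assume le: "derived \<subseteq> derived2"
  have "derived \<subseteq> derived_series br k" for k
  proof (induct k)
    case (Suc k)
    then have "{br x y | x y. x \<in> derived \<and> y \<in> derived}
        \<subseteq> {br x y | x y. x \<in> derived_series br k \<and> y \<in> derived_series br k}" by blast
    then have "derived2 \<subseteq> derived_series br (Suc k)" unfolding derived2_def by (simp add: span_mono)
    with le show ?case by blast
  qed simp
  moreover obtain k where "derived_series br k = {0}" using solvable by (auto simp: solvable_lie_def)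
  ultimately have "derived \<subseteq> {0}" by metis
  then show False using noncommutative br_in_derived by blast
qed

lemma dim_derived2: "dim derived2 \<le> 1"
  using ideal_dichotomy[OF ideal_derived2] derived_ne_derived2 by blast

text \<open>
  The algebra acts on the line \<open>derived2\<close> by scalars, which commute, so brackets act by zero.
\<close>
lemma derived2_central:
  assumes "u \<in> derived" "z \<in> derived2"
  shows "br u z = 0" "br z u = 0"
proof -
  obtain z0 where z0: "derived2 = span {z0}" using subspace_line[OF subspace_derived2 dim_derived2] .
  have "z0 \<in> derived2" using z0 by (simp add: span_base)
  then have "br x z0 \<in> span {z0}" for x using br_derived2[of z0 x] z0 by simp
  then have "\<exists>c. br x z0 = c *\<^sub>R z0" for x by (simp add: span_singleton image_iff)
  then obtain c where c: "\<And>x. br x z0 = c x *\<^sub>R z0" by metis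
  have "derived \<subseteq> {u. br u z0 = 0}"
  proof (rule derived_subset)
    show "subspace {u. br u z0 = 0}" by (auto simp: subspace_def br_simps)
    show "br x y \<in> {u. br u z0 = 0}" for x y
      using br_derivation[of x y z0] by (simp add: c br_simps mult.commute)
  qed
  then have "br u z0 = 0" using assms(1) by blast
  moreover obtain k where "z = k *\<^sub>R z0" using assms(2) z0 by (auto simp: span_singleton)
  ultimately show "br u z = 0" by (simp add: br_simps)
  then show "br z u = 0" using br_anti[of z u] by simp
qed

text \<open>
  The line through a central vector outside the derived algebra is complemented by the kernel of
  a functional that vanishes on the derived algebra; this kernel is automatically an ideal.
\<close>
lemma central_imp_decomposable:
  assumes c: "\<And>y. br y c = 0" "c \<notin> derived"
  shows "decomposable br"
proof -
  obtain f where f: "linear f" "\<And>x. x \<in> derived \<Longrightarrow> f x = 0" "f c = (1::real)"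
    using functional_separating_subspace[OF subspace_derived c(2)] by metis
  let ?J = "{x. f x = 0}"
  have "lie_ideal br (span {c})"
    unfolding lie_ideal_def
  proof (intro conjI allI ballI)
    fix x y assume "y \<in> span {c}"
    then obtain k where "y = k *\<^sub>R c" by (auto simp: span_singleton)
    then show "br x y \<in> span {c}" by (simp add: br_simps c(1) span_zero)
  qed simp
  moreover have "lie_ideal br ?J"
    using f br_in_derived by (auto simp: lie_ideal_def subspace_def linear_0 linear_add linear_cmul)
  moreover have "span {c} \<noteq> {0}" 
  proof -
    have "c \<in> span {c}" by (simp add: span_base)
    moreover have "c \<noteq> 0" using f(3) linear_0[OF f(1)] by auto
    ultimately show ?thesis by blast
  qed
  moreover have "?J \<noteq> {0}"
  proof -
    obtain u v where "br u v \<noteq> 0" using noncommutative by blast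
    then show ?thesis using f(2)[OF br_in_derived[of u v]] by blast
  qed
  moreover have "span {c} \<inter> ?J = {0}" using f by (auto simp: span_singleton linear_cmul linear_0)
  moreover have "{x + y | x y. x \<in> span {c} \<and> y \<in> ?J} = UNIV"
  proof (intro set_eqI iffI UNIV_I)
    fix v
    have "f v *\<^sub>R c \<in> span {c}" by (simp add: span_mul span_base)
    moreover have "v - f v *\<^sub>R c \<in> ?J" using f by (simp add: linear_diff linear_cmul)
    ultimately have "\<exists>x y. v = x + y \<and> x \<in> span {c} \<and> y \<in> ?J"
      by (intro exI[of _ "f v *\<^sub>R c"] exI[of _ "v - f v *\<^sub>R c"]) auto
    then show "v \<in> {x + y | x y. x \<in> span {c} \<and> y \<in> ?J}" by blast
  qed
  ultimately show ?thesis unfolding decomposable_def by blast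
qed

lemma alternating_form_functional:
  assumes "linear f"
  shows "alternating_form (\<lambda>x y. f (br x y))"
proof
  show "bilinear (\<lambda>x y. f (br x y))"
    unfolding bilinear_def
    using linear_compose[OF linear_br assms] linear_compose[OF linear_br_left assms]
    by (simp add: o_def)
  show "f (br x x) = 0" for x using assms by (simp add: br_self linear_0)
qed

text \<open>
  A form with a line radical lives in odd dimension, since the other basis vectors come in pairs;
  this excludes dimension four.
\<close>
lemma dim_ge_5: "DIM('a) \<ge> 5"
proof -
  obtain u v where uv: "br u v \<noteq> 0" using noncommutative by blast
  then obtain f where f: "linear f" "f (br u v) = (1::real)"
    using functional_separating_subspace[of "{0}" "br u v"] by auto
  have rad: "dim (radical f) = 1" by (rule line_radical[OF f(1), of u v]) (use f in simp)
  then obtain r where r: "r \<in> radical f" "r \<noteq> 0" using nonzero_vector_of_dim[of "radical f"] by auto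
  interpret alternating_form "\<lambda>x y. f (br x y)" by (rule alternating_form_functional[OF f(1)])
  have r0: "f (br r y) = 0" for y using r(1) by (simp add: radical_def)
  obtain m where "DIM('a) = 2 * m + 1"
    using symplectic_basis_line_radical[OF r0 r(2) rad[unfolded radical_def]] by metis
  then show ?thesis using dim_ge_4 by presburger
qed

text \<open>
  With a derived line \<open>\<langle>z\<rangle>\<close> the bracket is \<open>f (br x y) z\<close> for one functional, and the radical of
  this form is the centre. If the centre is the derived line, a symplectic basis is a Heisenberg
  basis; otherwise the centre splits off.
\<close>
lemma heisenberg_or_decomposable:
  assumes "dim derived = 1" "\<not> decomposable br"
  obtains m where "m \<ge> 1" "lie_iso_described br (heisenberg_basis m) (heisenberg_brackets m)"
proof -
  obtain z where z: "derived = span {z}" using subspace_line[OF subspace_derived] assms(1) by auto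
  have "z \<noteq> 0" using z assms(1) by auto
  then obtain f where f: "linear f" "f z = (1::real)"
    using functional_separating_subspace[of "{0}" z] by auto
  have br: "br x y = f (br x y) *\<^sub>R z" for x y
  proof -
    obtain k where "br x y = k *\<^sub>R z" using br_in_derived[of x y] z by (auto simp: span_singleton)
    then show ?thesis using f by (simp add: linear_cmul)
  qed
  obtain u v where "br u v \<noteq> 0" using noncommutative by blast
  then have "f (br u v) \<noteq> 0" using br[of u v] by (metis scaleR_zero_left)
  then have rad: "dim (radical f) = 1" by (rule line_radical[OF f(1)])
  then obtain r where r: "r \<in> radical f" "r \<noteq> 0" using nonzero_vector_of_dim[of "radical f"] by auto
  have "br r y = 0" for y by (subst br) (use r(1) in \<open>simp add: radical_def\<close>)
  then have rc: "br y r = 0" for y using br_anti[of y r] by simp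
  have "r \<in> derived" using central_imp_decomposable[of r] rc assms(2) by blast
  then obtain k where k: "r = k *\<^sub>R z" using z by (auto simp: span_singleton)
  then have zc: "br z y = 0" for y
    using \<open>br r y = 0\<close> r(2) by (auto simp: br_simps)
  interpret alternating_form "\<lambda>x y. f (br x y)" by (rule alternating_form_functional[OF f(1)])
  obtain m e where h: "hyperbolic (\<lambda>x y. f (br x y)) m e" and e: "e gz = z"
    "inj_on e (heisenberg_basis m)" "independent (e ` heisenberg_basis m)"
    "span (e ` heisenberg_basis m) = UNIV" "DIM('a) = 2 * m + 1"
    by (rule symplectic_basis_line_radical[OF _ \<open>z \<noteq> 0\<close> rad[unfolded radical_def]])
       (simp_all add: zc linear_0[OF f(1)])
  have m: "m \<ge> 1" using e(5) dim_ge_4 by simp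
  have xy: "br (e (gx i)) (e (gy j)) = (if i = j then z else 0)"
      and xx: "br (e (gx i)) (e (gx j)) = 0" and yy: "br (e (gy i)) (e (gy j)) = 0"
    if "i \<in> {1..m}" "j \<in> {1..m}" for i j
    by (subst br, simp add: hyperbolicD[OF h that])+
  have yx: "br (e (gy i)) (e (gx j)) = (if i = j then - z else 0)"
    if "i \<in> {1..m}" "j \<in> {1..m}" for i j
    using xy[OF that(2,1)] br_anti[of "e (gy i)" "e (gx j)"] by auto
  have yz: "br y z = 0" for y using zc[of y] br_anti[of y z] by simp
  have "br (e a) (e b) = 0"
    if "a \<in> heisenberg_basis m" "b \<in> heisenberg_basis m"
      and no: "\<forall>c d. (a, b, c, d) \<notin> heisenberg_brackets m \<and> (b, a, c, d) \<notin> heisenberg_brackets m" for a b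
    using that
    by (cases a; cases b) (auto simp: heisenberg_basis_def heisenberg_brackets_def e(1) xx yy xy yx zc yz)
  moreover have "br (e (gx i)) (e (gy i)) = 1 *\<^sub>R e gz" if "i \<in> {1..m}" for i
    using xy[OF that that] e(1) by simp
  ultimately have "lie_iso_described br (heisenberg_basis m) (heisenberg_brackets m)"
    unfolding lie_iso_described_def
    using e(2-4) by (intro exI[of _ e]) (auto simp: heisenberg_brackets_def)
  with m show thesis by (rule that)
qed

text \<open>
  This projection onto a complement of \<open>derived2\<close> replaces the passage to the quotient space.
\<close>
lemma projection_modulo_derived2:
  obtains p where "linear p" "\<And>v. v \<in> derived2 \<Longrightarrow> p v = 0" "\<And>x. x - p x \<in> derived2"
proof -
  obtain z where z: "derived2 = span {z}" using subspace_line[OF subspace_derived2 dim_derived2] .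
  let ?p = "\<lambda>x. x - (x \<bullet> z / (z \<bullet> z)) *\<^sub>R z"
  have "linear ?p"
    by (intro linearI) (auto simp: inner_add_left add_divide_distrib algebra_simps)
  moreover have "?p v = 0" if "v \<in> derived2" for v
    using that by (cases "z = 0") (auto simp: z span_singleton)
  moreover have "x - ?p x \<in> derived2" for x
    by (simp add: z span_mul span_base)
  ultimately show thesis by (rule that)
qed

end

text \<open>
  The image of the derived algebra under \<open>p\<close> models the quotient \<open>derived / derived2\<close>, on which the
  adjoint action becomes a commuting family of operators. It is a plane, as shown below.
\<close>
locale derived_plane = line_radical_algebra br
  for br :: "'a::euclidean_space \<Rightarrow> 'a \<Rightarrow> 'a" +
  fixes p :: "'a \<Rightarrow> 'a"
  assumes linear_p: "linear p"
    and p_derived2: "v \<in> derived2 \<Longrightarrow> p v = 0"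
    and p_diff: "x - p x \<in> derived2"
    and dim_derived: "dim derived \<ge> 2"
begin

definition quotient_plane :: "'a set" where
  "quotient_plane = p ` derived"

lemma p_zero_iff: "p x = 0 \<longleftrightarrow> x \<in> derived2"
  using p_derived2[of x] p_diff[of x] by auto

lemma p_idem: "p (p x) = p x"
  using p_derived2[OF p_diff[of x]] by (simp add: linear_diff[OF linear_p])

lemma p_eq: "x - y \<in> derived2 \<Longrightarrow> p x = p y"
  using p_derived2[of "x - y"] by (simp add: linear_diff[OF linear_p])

lemma subspace_quotient_plane: "subspace quotient_plane"
  unfolding quotient_plane_def by (rule linear_subspace_image[OF linear_p subspace_derived])

lemma p_in_derived: assumes "v \<in> derived" shows "p v \<in> derived"
proof -
  have "v - (v - p v) \<in> derived"
    by (rule subspace_diff[OF subspace_derived assms])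
       (use p_diff[of v] derived2_subset_derived in blast)
  then show ?thesis by simp
qed

lemma quotient_plane_derived: "v \<in> quotient_plane \<Longrightarrow> v \<in> derived"
  using p_in_derived by (auto simp: quotient_plane_def)

lemma p_quotient_plane: "v \<in> quotient_plane \<Longrightarrow> p v = v"
  by (auto simp: quotient_plane_def p_idem)

lemma p_in_quotient_plane: "v \<in> derived \<Longrightarrow> p v \<in> quotient_plane"
  by (simp add: quotient_plane_def)

lemma p_br_p: "p (br x (p v)) = p (br x v)"
proof (rule p_eq[symmetric])
  show "br x v - br x (p v) \<in> derived2" using br_derived2[OF p_diff[of v], of x] by (simp add: br_simps)
qed

sublocale act: commuting_operators quotient_plane UNIV "\<lambda>x v. p (br x v)"
proof (rule commuting_operators.intro)
  show "linear (\<lambda>v. p (br x v))" for x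
    using linear_compose[OF linear_br linear_p] by (simp add: o_def)
  show "p (br x v) \<in> quotient_plane" if "v \<in> quotient_plane" for x v by (intro p_in_quotient_plane br_in_derived)
  show "p (br x (p (br y v))) = p (br y (p (br x v)))" if "v \<in> quotient_plane" for x y v
    unfolding p_br_p
    by (rule p_eq)
       (use br_in_derived2[OF br_in_derived[of x y] quotient_plane_derived[OF that]] in
         \<open>simp add: br_derivation[of x y]\<close>)
qed (rule subspace_quotient_plane)

text \<open>
  The preimage of an invariant subspace in the derived algebra is an ideal.
\<close>
lemma quotient_plane_nearly_irreducible:
  assumes "act.invariant Y"
  shows "dim Y \<le> 1 \<or> Y = quotient_plane"
proof -
  have Y: "subspace Y" "Y \<subseteq> quotient_plane" "\<And>x v. v \<in> Y \<Longrightarrow> p (br x v) \<in> Y"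
    using assms by (auto simp: act.invariant_def)
  let ?I = "{v \<in> derived. p v \<in> Y}"
  have "lie_ideal br ?I"
    unfolding lie_ideal_def
  proof (intro conjI allI ballI)
    show "subspace ?I" using subspace_derived Y(1)
      by (auto simp: subspace_def linear_0[OF linear_p] linear_add[OF linear_p] linear_cmul[OF linear_p])
    show "br x v \<in> ?I" if "v \<in> ?I" for x v
      using Y(3)[of "p v" x] that br_in_derived by (simp add: p_br_p)
  qed
  then have "dim ?I \<le> 1 \<or> derived \<subseteq> ?I" by (rule ideal_dichotomy)
  moreover have "Y \<subseteq> ?I" using Y(2) quotient_plane_derived p_quotient_plane by auto
  then have "dim Y \<le> dim ?I" by (rule dim_subset)
  moreover have "quotient_plane \<subseteq> Y" if "derived \<subseteq> ?I" using that by (auto simp: quotient_plane_def)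
  ultimately show ?thesis using Y(2) by force
qed

text \<open>
  If the quotient were at most a line, the derived algebra would be generated by one element modulo
  its central part \<open>derived2\<close>, hence abelian; then \<open>derived2 = 0\<close> and the quotient is the derived
  algebra itself, of dimension at least two.
\<close>
lemma dim_quotient_plane: "dim quotient_plane = 2"
proof -
  have "dim quotient_plane \<le> 2" by (rule act.dim_le_2[OF quotient_plane_nearly_irreducible])
  moreover have "\<not> dim quotient_plane \<le> 1"
  proof
    assume "dim quotient_plane \<le> 1"
    then obtain u where u: "quotient_plane = span {u}" using subspace_line[OF subspace_quotient_plane] by metis
    have du: "u \<in> derived" using u quotient_plane_derived by (simp add: span_base)
    have dec: "\<exists>c. v - c *\<^sub>R u \<in> derived2" if "v \<in> derived" for v
      using p_in_quotient_plane[OF that] p_diff[of v] u by (auto simp: span_singleton)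
    have "br v w = 0" if v: "v \<in> derived" and w: "w \<in> derived" for v w
    proof -
      obtain c d where c: "v - c *\<^sub>R u \<in> derived2" and d: "w - d *\<^sub>R u \<in> derived2"
        using dec[OF v] dec[OF w] by blast
      have "br v w = br (v - c *\<^sub>R u) w + c *\<^sub>R br u w" by (simp add: br_simps)
      also have "\<dots> = c *\<^sub>R (br u (w - d *\<^sub>R u) + d *\<^sub>R br u u)"
        using derived2_central(2)[OF w c] by (simp add: br_simps)
      also have "\<dots> = 0" using derived2_central(1)[OF du d] by (simp add: br_self)
      finally show ?thesis .
    qed
    then have "derived2 \<subseteq> {0}" by (intro derived2_subset) auto
    then have "p x = x" for x using p_diff[of x] by auto
    then have "quotient_plane = derived" by (auto simp: quotient_plane_def)
    then show False using \<open>dim quotient_plane \<le> 1\<close> dim_derived by simp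
  qed
  ultimately show ?thesis by simp
qed

text \<open>
  The operators on the plane \<open>quotient_plane\<close> form a commutative family, so they lie in \<open>\<langle>1, T\<rangle>\<close> for one of
  them. Were the identity missing, the elements acting by zero would have codimension at most one,
  and a functional that makes them isotropic would have a radical of dimension at least
  \<open>DIM('a) - 2\<close>.
\<close>
lemma grading_element_exists:
  obtains x1 where "\<And>v. v \<in> quotient_plane \<Longrightarrow> p (br x1 v) = v"
proof -
  have "\<exists>x1. \<forall>v\<in>quotient_plane. p (br x1 v) = v"
  proof (rule ccontr)
    assume no: "\<nexists>x1. \<forall>v\<in>quotient_plane. p (br x1 v) = v"
    obtain x2 where x2: "\<And>x. \<exists>a b. \<forall>v\<in>quotient_plane. p (br x v) = a *\<^sub>R v + b *\<^sub>R p (br x2 v)"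
      using act.plane_commutant[OF dim_quotient_plane] by auto
    define C where "C = {x. \<forall>v\<in>quotient_plane. p (br x v) = 0}"
    have cod: "\<exists>b. x - b *\<^sub>R x2 \<in> C" for x
    proof -
      obtain a b where ab: "\<And>v. v \<in> quotient_plane \<Longrightarrow> p (br x v) = a *\<^sub>R v + b *\<^sub>R p (br x2 v)"
        using x2 by blast
      have "a = 0"
      proof (rule ccontr)
        assume a: "a \<noteq> 0"
        have "p (br ((1 / a) *\<^sub>R (x - b *\<^sub>R x2)) v) = v" if "v \<in> quotient_plane" for v
          using ab[OF that] a
          by (simp add: br_simps linear_diff[OF linear_p] linear_cmul[OF linear_p])
        then show False using no by blast
      qed
      then have "x - b *\<^sub>R x2 \<in> C"
        using ab by (simp add: C_def br_simps linear_diff[OF linear_p] linear_cmul[OF linear_p])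
      then show ?thesis by blast
    qed
    have C_br: "br c g \<in> derived2" if "c \<in> C" "g \<in> derived" for c g
    proof -
      have "p (br c (p g)) = 0" using that p_in_quotient_plane by (simp add: C_def)
      then show ?thesis by (simp add: p_br_p p_zero_iff)
    qed
    have subC: "subspace C"
      by (auto simp: C_def subspace_def br_simps linear_0[OF linear_p] linear_add[OF linear_p]
          linear_cmul[OF linear_p])
    define W where "W = span {br c d | c d. c \<in> C \<and> d \<in> C}"
    have subW: "subspace W" by (simp add: W_def)
    \<comment> \<open>Brackets of elements of \<open>C\<close> are mapped into \<open>derived2\<close> by the whole algebra. If they spanned the
      derived algebra, a functional vanishing on \<open>derived2\<close> would have all of it in its radical.\<close>
    have "\<not> derived \<subseteq> W"
    proof
      assume dW: "derived \<subseteq> W"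
      have "W \<subseteq> {g. br y g \<in> derived2}" for y
        unfolding W_def
      proof (rule span_minimal)
        show "subspace {g. br y g \<in> derived2}"
          using subspace_derived2 by (auto simp: subspace_def br_simps)
        have "br y (br c d) \<in> derived2" if "c \<in> C" "d \<in> C" for c d
        proof -
          have "br (br y c) d = - br d (br y c)" by (rule br_anti)
          moreover have "br d (br y c) \<in> derived2" "br c (br y d) \<in> derived2"
            using that C_br br_in_derived by auto
          ultimately show ?thesis
            unfolding br_derivation[of y] using subspace_derived2 by (simp add: subspace_diff)
        qed
        then show "{br c d | c d. c \<in> C \<and> d \<in> C} \<subseteq> {g. br y g \<in> derived2}" by auto
      qed
      then have dd: "br y g \<in> derived2" if "g \<in> derived" for y g using that dW by blast
      obtain u v where "br u v \<notin> derived2"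
        using derived_subset[OF subspace_derived2] derived_ne_derived2 by blast
      then obtain f where f: "linear f" "\<And>x. x \<in> derived2 \<Longrightarrow> f x = 0" "f (br u v) = (1::real)"
        using functional_separating_subspace[OF subspace_derived2] by metis
      have "f (br g y) = 0" if "g \<in> derived" for g y
        using f(2)[OF dd[OF that]] br_anti[of g y] by (simp add: linear_neg[OF f(1)])
      then have "derived \<subseteq> radical f" by (auto simp: radical_def)
      then have "dim derived \<le> dim (radical f)" by (rule dim_subset)
      then show False using line_radical[OF f(1), of u v] f(3) dim_derived by simp
    qed
    then obtain u v where "br u v \<notin> W" using derived_subset[OF subW] by blast
    then obtain f where f: "linear f" "\<And>x. x \<in> W \<Longrightarrow> f x = 0" "f (br u v) = (1::real)"
      using functional_separating_subspace[OF subW] by metis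
    have rad: "dim (radical f) = 1" using line_radical[OF f(1), of u v] f(3) by simp
    note fl = linear_diff[OF f(1)] linear_cmul[OF f(1)] linear_add[OF f(1)] linear_neg[OF f(1)]
    have "\<exists>c0\<in>C. \<forall>c\<in>C. \<exists>t. f (br x2 (c - t *\<^sub>R c0)) = 0"
    proof (cases "\<exists>c0\<in>C. f (br x2 c0) \<noteq> 0")
      case True
      then obtain c0 where c0: "c0 \<in> C" "f (br x2 c0) \<noteq> 0" by blast
      have "f (br x2 (c - (f (br x2 c) / f (br x2 c0)) *\<^sub>R c0)) = 0" for c
        using c0(2) by (simp add: br_simps fl)
      then show ?thesis using c0(1) by blast
    next
      case False
      then show ?thesis using subspace_0[OF subC] by (intro bexI[of _ 0]) auto
    qed
    then obtain c0 where c0: "c0 \<in> C" "\<And>c. c \<in> C \<Longrightarrow> \<exists>t. f (br x2 (c - t *\<^sub>R c0)) = 0" by blast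
    have in_rad: "c \<in> radical f" if c: "c \<in> C" "f (br x2 c) = 0" for c
      unfolding radical_def
    proof (clarify)
      fix y
      obtain b where b: "y - b *\<^sub>R x2 \<in> C" using cod by blast
      have "br c (y - b *\<^sub>R x2) \<in> W" unfolding W_def by (rule span_base) (use c b in blast)
      then have "f (br c (y - b *\<^sub>R x2)) = 0" by (rule f(2))
      moreover have "f (br c x2) = 0" using c(2) br_anti[of c x2] by (simp add: fl)
      ultimately show "f (br c y) = 0" by (simp add: br_simps fl)
    qed
    have "UNIV \<subseteq> span (insert x2 (insert c0 (radical f)))"
    proof
      fix x
      obtain b where b: "x - b *\<^sub>R x2 \<in> C" using cod by blast
      then obtain t where t: "f (br x2 (x - b *\<^sub>R x2 - t *\<^sub>R c0)) = 0" using c0(2) by blast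
      have "x - b *\<^sub>R x2 - t *\<^sub>R c0 \<in> C" using b c0(1) subC by (simp add: subspace_diff subspace_mul)
      then have "x - b *\<^sub>R x2 - t *\<^sub>R c0 \<in> radical f" using t by (rule in_rad)
      then show "x \<in> span (insert x2 (insert c0 (radical f)))"
        unfolding span_breakdown_eq by (blast intro: span_base)
    qed
    then have "DIM('a) \<le> dim (insert x2 (insert c0 (radical f)))"
      using dim_subset[of UNIV "span (insert x2 (insert c0 (radical f)))"] by (simp only: dim_span dim_UNIV)
    also have "\<dots> \<le> dim (insert c0 (radical f)) + 1" by (simp add: dim_insert)
    also have "\<dots> \<le> dim (radical f) + 1 + 1" by (simp add: dim_insert)
    finally show False using rad dim_ge_4 by simp
  qed
  then show thesis using that by blast
qed

end

section \<open>The graded case\<close>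

text \<open>
  The element \<open>x1\<close> acts as the identity on the plane and, being a derivation, as \<open>2\<close> on \<open>derived2\<close>.
  Its eigenspaces lift the quotient plane back to an honest subspace \<open>eigenplane\<close> and provide an abelian
  complement of the derived algebra, the kernel of \<open>ad x1\<close>.
\<close>
locale graded_algebra = derived_plane br p
  for br :: "'a::euclidean_space \<Rightarrow> 'a \<Rightarrow> 'a" and p :: "'a \<Rightarrow> 'a" +
  fixes x1 :: 'a
  assumes x1_quotient_plane: "v \<in> quotient_plane \<Longrightarrow> p (br x1 v) = v"
    and indecomposable: "\<not> decomposable br"
begin

definition eigenplane :: "'a set" where
  "eigenplane = {v \<in> derived. br x1 v = v}"

definition centralizer :: "'a set" where
  "centralizer = {k. br x1 k = 0}"

lemma x1_derived: assumes "v \<in> derived" shows "br x1 v - v \<in> derived2"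
proof -
  have "p (br x1 v) = p v" using x1_quotient_plane[OF p_in_quotient_plane[OF assms]] by (simp add: p_br_p)
  then have "p (br x1 v - v) = 0" by (simp add: linear_diff[OF linear_p])
  then show ?thesis by (simp add: p_zero_iff)
qed

text \<open>
  On a bracket of derived elements \<open>x1\<close> acts twice as the identity; the corrections lie in \<open>derived2\<close>
  and are central in the derived algebra.
\<close>
lemma x1_derived2: assumes "z \<in> derived2" shows "br x1 z = 2 *\<^sub>R z"
proof -
  have "derived2 \<subseteq> {z. br x1 z = 2 *\<^sub>R z}"
  proof (rule derived2_subset)
    show "subspace {z. br x1 z = 2 *\<^sub>R z}" by (auto simp: subspace_def br_simps scaleR_add_right)
    fix u v assume u: "u \<in> derived" and v: "v \<in> derived"
    have "br (br x1 u - u) v = 0" "br u (br x1 v - v) = 0"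
      using derived2_central[OF v x1_derived[OF u]] derived2_central[OF u x1_derived[OF v]] by auto
    then have "br (br x1 u) v = br u v" "br u (br x1 v) = br u v" by (simp_all add: br_simps)
    then show "br u v \<in> {z. br x1 z = 2 *\<^sub>R z}"
      by (simp add: br_derivation[of x1] scaleR_2)
  qed
  then show ?thesis using assms by blast
qed

lemma subspace_eigenplane: "subspace eigenplane"
  using subspace_derived by (auto simp: eigenplane_def subspace_def br_simps)

lemma subspace_centralizer: "subspace centralizer"
  by (auto simp: centralizer_def subspace_def br_simps)

lemma eigenplane_derived: "v \<in> eigenplane \<Longrightarrow> v \<in> derived"
  and eigenplane_br: "v \<in> eigenplane \<Longrightarrow> br x1 v = v"
  by (simp_all add: eigenplane_def)

lemma eigenplane_derived2: assumes "v \<in> eigenplane" "v \<in> derived2" shows "v = 0"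
proof -
  have "v = v + v" using x1_derived2[OF assms(2)] eigenplane_br[OF assms(1)] by (simp add: scaleR_2)
  then show ?thesis by simp
qed

text \<open>
  Modulo \<open>derived2\<close> the vector \<open>g\<close> is fixed by \<open>x1\<close>. Its defect \<open>[x1, g] - g\<close> has eigenvalue two, so
  subtracting it once yields an eigenvector for the eigenvalue one.
\<close>
lemma derived_decomposition:
  assumes "g \<in> derived"
  obtains v z where "v \<in> eigenplane" "z \<in> derived2" "g = v + z"
proof -
  let ?z = "br x1 g - g"
  have z: "?z \<in> derived2" by (rule x1_derived[OF assms])
  have "br x1 (g - ?z) = br x1 g - 2 *\<^sub>R ?z"
    using x1_derived2[OF z] bilinear_rsub[OF bilinear_br, of x1 g ?z] by simp
  also have "\<dots> = g - ?z" by (simp add: scaleR_2)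
  finally have "br x1 (g - ?z) = g - ?z" .
  moreover have "g - ?z \<in> derived"
    using z derived2_subset_derived subspace_diff[OF subspace_derived assms] by blast
  ultimately have "g - ?z \<in> eigenplane" by (simp add: eigenplane_def)
  then show thesis using z by (rule that) simp
qed

lemma dim_eigenplane: "dim eigenplane = 2"
proof -
  have "p ` eigenplane = quotient_plane"
  proof
    show "p ` eigenplane \<subseteq> quotient_plane" using eigenplane_derived p_in_quotient_plane by blast
    show "quotient_plane \<subseteq> p ` eigenplane"
    proof
      fix x assume "x \<in> quotient_plane"
      then obtain g where g: "g \<in> derived" "x = p g" by (auto simp: quotient_plane_def)
      obtain v z where "v \<in> eigenplane" "z \<in> derived2" "g = v + z"
        by (rule derived_decomposition[OF g(1)])
      then show "x \<in> p ` eigenplane" using g(2) p_derived2 by (auto simp: linear_add[OF linear_p])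
    qed
  qed
  moreover have "dim (p ` eigenplane) = dim eigenplane"
  proof (rule dim_image_eq[OF linear_p])
    have "inj_on p eigenplane"
    proof (rule inj_onI)
      fix x y assume xy: "x \<in> eigenplane" "y \<in> eigenplane" "p x = p y"
      then have "x - y \<in> derived2" by (simp add: linear_diff[OF linear_p] flip: p_zero_iff)
      moreover have "x - y \<in> eigenplane" using subspace_eigenplane xy by (simp add: subspace_diff)
      ultimately show "x = y" using eigenplane_derived2[of "x - y"] by simp
    qed
    then show "inj_on p (span eigenplane)" using subspace_eigenplane by (metis span_eq_iff)
  qed
  ultimately show ?thesis using dim_quotient_plane by simp
qed

lemma centralizer_derived: assumes "k \<in> centralizer" "k \<in> derived" shows "k = 0"
proof -
  obtain v z where vz: "v \<in> eigenplane" "z \<in> derived2" "k = v + z"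
    by (rule derived_decomposition[OF assms(2)])
  have "v + 2 *\<^sub>R z = 0"
    using assms(1) vz x1_derived2 eigenplane_br by (simp add: centralizer_def br_simps)
  then have v: "v = - (2 *\<^sub>R z)" by (simp add: eq_neg_iff_add_eq_0)
  then have "v \<in> derived2" using vz(2) subspace_derived2 by (simp add: subspace_neg subspace_mul)
  then have "v = 0" using eigenplane_derived2 vz(1) by blast
  then show ?thesis using v vz(3) by simp
qed

text \<open>
  Since \<open>ad x1\<close> maps into the derived algebra and is invertible there, its kernel is a complement.
\<close>
lemma centralizer_decomposition:
  obtains k v z where "k \<in> centralizer" "v \<in> eigenplane" "z \<in> derived2" "x = k + v + z"
proof -
  obtain v z where vz: "v \<in> eigenplane" "z \<in> derived2" "br x1 x = v + z"
    by (rule derived_decomposition[OF br_in_derived])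
  have z: "(1/2) *\<^sub>R z \<in> derived2" using vz(2) subspace_derived2 by (simp add: subspace_mul)
  have "br x1 (x - v - (1/2) *\<^sub>R z) = 0"
    using vz x1_derived2 eigenplane_br by (simp add: br_simps)
  then have "x - v - (1/2) *\<^sub>R z \<in> centralizer" by (simp add: centralizer_def)
  then show thesis using vz(1) z by (rule that) simp
qed

lemma centralizer_abelian: assumes "k \<in> centralizer" "l \<in> centralizer" shows "br k l = 0"
proof (rule centralizer_derived[OF _ br_in_derived])
  show "br k l \<in> centralizer" using assms by (simp add: centralizer_def br_derivation[of x1] br_simps)
qed

lemma centralizer_br_eigenplane: assumes "k \<in> centralizer" "v \<in> eigenplane" shows "br k v \<in> eigenplane"
  using assms br_in_derived by (simp add: centralizer_def eigenplane_def br_derivation[of x1] br_simps)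

lemma x1_centralizer: "x1 \<in> centralizer"
  by (simp add: centralizer_def br_self)

text \<open>
  An element of the complement that kills the plane kills \<open>derived2\<close>, which the plane generates, and
  commutes with the complement. It is central and outside the derived algebra, which contradicts
  indecomposability.
\<close>
lemma centralizer_kernel_trivial:
  assumes k: "k \<in> centralizer" and kill: "\<And>v. v \<in> eigenplane \<Longrightarrow> br k v = 0"
  shows "k = 0"
proof (rule ccontr)
  assume "k \<noteq> 0"
  then have "k \<notin> derived" using centralizer_derived[OF k] by blast
  moreover have "br y k = 0" for y
  proof -
    obtain l v z where y: "l \<in> centralizer" "v \<in> eigenplane" "z \<in> derived2" "y = l + v + z"
      by (rule centralizer_decomposition)
    have "derived2 \<subseteq> {z. br k z = 0}"
    proof (rule derived2_subset)
      show "subspace {z. br k z = 0}" by (auto simp: subspace_def br_simps)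
      have kd: "br k g \<in> derived2" if g: "g \<in> derived" for g
      proof -
        obtain v z where "v \<in> eigenplane" "z \<in> derived2" "g = v + z"
          by (rule derived_decomposition[OF g])
        then show ?thesis using kill br_derived2 by (simp add: br_simps)
      qed
      show "br u w \<in> {z. br k z = 0}" if "u \<in> derived" "w \<in> derived" for u w
        using derived2_central[OF that(2) kd[OF that(1)]] derived2_central[OF that(1) kd[OF that(2)]]
        by (simp add: br_derivation[of k])
    qed
    then have "br k z = 0" using y(3) by blast
    then have "br k y = 0" using y kill centralizer_abelian[OF k] by (simp add: br_simps)
    then show ?thesis using br_anti[of y k] by simp
  qed
  ultimately show False using central_imp_decomposable indecomposable by blast
qed

text \<open>
  An element of the complement is determined by its action on the plane, and these actions
  commute, so the complement is spanned by two elements.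
\<close>
lemma centralizer_spanned:
  obtains x2 where "x2 \<in> centralizer" "\<And>k. k \<in> centralizer \<Longrightarrow> \<exists>a b. k = a *\<^sub>R x1 + b *\<^sub>R x2"
proof -
  interpret centralizer: commuting_operators eigenplane centralizer br
  proof (rule commuting_operators.intro)
    show "br i (br j v) = br j (br i v)" if "i \<in> centralizer" "j \<in> centralizer" "v \<in> eigenplane" for i j v
      using br_derivation[of i j v] centralizer_abelian[OF that(1,2)] by (simp add: br_simps)
  qed (auto simp: subspace_eigenplane linear_br centralizer_br_eigenplane)
  obtain x2 where x2: "x2 \<in> centralizer"
    "\<And>k. k \<in> centralizer \<Longrightarrow> \<exists>a b. \<forall>v\<in>eigenplane. br k v = a *\<^sub>R v + b *\<^sub>R br x2 v"
    using centralizer.plane_commutant[OF dim_eigenplane] x1_centralizer by blast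
  have "\<exists>a b. k = a *\<^sub>R x1 + b *\<^sub>R x2" if k: "k \<in> centralizer" for k
  proof -
    obtain a b where ab: "\<And>v. v \<in> eigenplane \<Longrightarrow> br k v = a *\<^sub>R v + b *\<^sub>R br x2 v"
      using x2(2)[OF k] by blast
    have "k - (a *\<^sub>R x1 + b *\<^sub>R x2) = 0"
    proof (rule centralizer_kernel_trivial)
      show "k - (a *\<^sub>R x1 + b *\<^sub>R x2) \<in> centralizer"
        using k x1_centralizer x2(1) subspace_centralizer by (intro subspace_diff subspace_add subspace_mul)
      show "br (k - (a *\<^sub>R x1 + b *\<^sub>R x2)) v = 0" if "v \<in> eigenplane" for v
        using ab[OF that] eigenplane_br[OF that] by (simp add: br_simps)
    qed
    then show ?thesis by (metis eq_iff_diff_eq_0)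
  qed
  with x2(1) show thesis by (rule that)
qed

text \<open>
  Otherwise the plane and the two generators of the complement would span at most four dimensions,
  but the dimension is odd and at least four.
\<close>
lemma derived2_nontrivial: "derived2 \<noteq> {0}"
proof
  assume d0: "derived2 = {0}"
  obtain x2 where x2: "x2 \<in> centralizer" "\<And>k. k \<in> centralizer \<Longrightarrow> \<exists>a b. k = a *\<^sub>R x1 + b *\<^sub>R x2"
    using centralizer_spanned by blast
  have "UNIV \<subseteq> span (insert x1 (insert x2 eigenplane))"
  proof
    fix x
    obtain k v z where x: "k \<in> centralizer" "v \<in> eigenplane" "z \<in> derived2" "x = k + v + z"
      by (rule centralizer_decomposition)
    obtain a b where "k = a *\<^sub>R x1 + b *\<^sub>R x2" using x2(2)[OF x(1)] by blast
    then have "x - a *\<^sub>R x1 - b *\<^sub>R x2 = v" using x d0 by simp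
    then have "x - a *\<^sub>R x1 - b *\<^sub>R x2 \<in> span eigenplane" using x(2) by (simp add: span_base)
    then show "x \<in> span (insert x1 (insert x2 eigenplane))" unfolding span_breakdown_eq by blast
  qed
  then have "DIM('a) \<le> dim (insert x1 (insert x2 eigenplane))"
    using dim_subset[of UNIV "span (insert x1 (insert x2 eigenplane))"] by (simp only: dim_span dim_UNIV)
  also have "\<dots> \<le> dim (insert x2 eigenplane) + 1" by (simp add: dim_insert)
  also have "\<dots> \<le> dim eigenplane + 1 + 1" by (simp add: dim_insert)
  finally show False using dim_eigenplane dim_ge_5 by simp
qed

text \<open>
  An eigenvector of the complement in the plane would span with \<open>derived2\<close> an ideal of dimension
  two inside the three-dimensional derived algebra.
\<close>
lemma no_common_eigenvector:
  assumes v: "v \<in> eigenplane" "v \<noteq> 0" and k: "\<And>k. k \<in> centralizer \<Longrightarrow> br k v \<in> span {v}"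
  shows False
proof -
  obtain z where z: "derived2 = span {z}" using subspace_line[OF subspace_derived2 dim_derived2] .
  have z0: "z \<noteq> 0"
  proof
    assume "z = 0"
    then have "derived2 = {0}" using z by simp
    then show False using derived2_nontrivial by blast
  qed
  have zd: "z \<in> derived2" using z by (simp add: span_base)
  have zv: "z \<notin> span {v}"
  proof
    assume "z \<in> span {v}"
    then obtain c where "z = c *\<^sub>R v" by (auto simp: span_singleton)
    then have "z \<in> eigenplane" using v(1) subspace_eigenplane by (simp add: subspace_mul)
    then show False using eigenplane_derived2 zd z0 by blast
  qed
  have "independent {z, v}" using v(2) zv by (simp add: independent_insert)
  moreover have "z \<noteq> v" using zv by (auto simp: span_base)
  ultimately have d2: "dim (span {z, v}) = 2" by (simp add: dim_eq_card_independent)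
  have "lie_ideal br (span {z, v})"
    unfolding lie_ideal_def
  proof (intro conjI allI ballI)
    have ds: "derived2 \<subseteq> span {z, v}" unfolding z by (rule span_mono) simp
    have vs: "span {v} \<subseteq> span {z, v}" by (rule span_mono) simp
    fix x y assume "y \<in> span {z, v}"
    then obtain a where "y - a *\<^sub>R z \<in> span {v}" by (auto simp: span_insert)
    then obtain b where "y - a *\<^sub>R z = b *\<^sub>R v" by (auto simp: span_singleton)
    then have y: "y = a *\<^sub>R z + b *\<^sub>R v" by (simp add: algebra_simps)
    obtain l w c where x: "l \<in> centralizer" "w \<in> eigenplane" "c \<in> derived2" "x = l + w + c"
      by (rule centralizer_decomposition)
    have "br l v \<in> span {z, v}" using k[OF x(1)] vs by blast
    moreover have "br w v \<in> span {z, v}"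
      using br_in_derived2[OF eigenplane_derived[OF x(2)] eigenplane_derived[OF v(1)]] ds by blast
    moreover have "br c v \<in> span {z, v}"
      using derived2_central(2)[OF eigenplane_derived[OF v(1)] x(3)] by (simp add: span_zero)
    ultimately have "br x v \<in> span {z, v}" by (simp add: x(4) br_simps span_add)
    moreover have "br x z \<in> span {z, v}" using br_derived2[OF zd] ds by blast
    ultimately show "br x y \<in> span {z, v}" by (simp add: y br_simps span_add span_mul)
  qed simp
  then have "derived \<subseteq> span {z, v}" using ideal_dichotomy[of "span {z, v}"] d2 by simp
  then have "eigenplane \<subseteq> span {z, v}" using eigenplane_derived by blast
  then have "eigenplane = span {z, v}"
    using subspace_eigenplane d2 dim_eigenplane by (intro subspace_dim_equal) auto
  then have "z \<in> eigenplane" by (simp add: span_base)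
  then show False using eigenplane_derived2 zd z0 by blast
qed

text \<open>
  Without eigenvector the second generator acts on the plane with complex eigenvalues, so a
  combination with \<open>x1\<close> squares to \<open>-1\<close>.
\<close>
lemma complex_structure:
  obtains j v where "j \<in> centralizer" "\<And>k. k \<in> centralizer \<Longrightarrow> \<exists>a b. k = a *\<^sub>R x1 + b *\<^sub>R j"
    "v \<in> eigenplane" "v \<noteq> 0" "br j (br j v) = - v"
proof -
  obtain x2 where x2: "x2 \<in> centralizer" "\<And>k. k \<in> centralizer \<Longrightarrow> \<exists>a b. k = a *\<^sub>R x1 + b *\<^sub>R x2"
    using centralizer_spanned by blast
  have noeig: False if u: "u \<in> eigenplane" "u \<noteq> 0" and e: "br x2 u \<in> span {u}" for u
  proof (rule no_common_eigenvector[OF u])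
    fix k assume "k \<in> centralizer"
    then obtain a b where "k = a *\<^sub>R x1 + b *\<^sub>R x2" using x2(2) by blast
    then have "br k u = a *\<^sub>R u + b *\<^sub>R br x2 u" using eigenplane_br[OF u(1)] by (simp add: br_simps)
    then show "br k u \<in> span {u}" using e by (simp add: span_add span_mul span_base)
  qed
  obtain v where v: "v \<in> eigenplane" "v \<noteq> 0"
    using nonzero_vector_of_dim[of eigenplane] dim_eigenplane by auto
  have Tv: "br x2 v \<in> eigenplane" by (rule centralizer_br_eigenplane[OF x2(1) v(1)])
  have "br x2 v \<notin> span {v}" using noeig[OF v] by blast
  then obtain c d where cd: "br x2 (br x2 v) = c *\<^sub>R v + d *\<^sub>R br x2 v"
    by (rule plane_spanned[OF subspace_eigenplane dim_eigenplane v Tv _ centralizer_br_eigenplane[OF x2(1) Tv]])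
  \<comment> \<open>Subtracting half the trace and completing the square.\<close>
  define s where "s = x2 - (d / 2) *\<^sub>R x1"
  define e where "e = c + d\<^sup>2 / 4"
  have s_centralizer: "s \<in> centralizer" unfolding s_def using x1_centralizer x2(1) subspace_centralizer
    by (intro subspace_diff subspace_mul)
  have sb: "br s u = br x2 u - (d / 2) *\<^sub>R u" if "u \<in> eigenplane" for u
    using eigenplane_br[OF that] by (simp add: s_def br_simps)
  have sv: "br s v \<in> eigenplane" by (rule centralizer_br_eigenplane[OF s_centralizer v(1)])
  have sq: "br s (br s v) = e *\<^sub>R v"
  proof -
    have "br s (br s v) = br x2 (br x2 v) - (d / 2) *\<^sub>R br x2 v - (d / 2) *\<^sub>R (br x2 v - (d / 2) *\<^sub>R v)"
      unfolding sb[OF sv] unfolding sb[OF v(1)] by (simp add: br_simps)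
    also have "\<dots> = c *\<^sub>R v + (d * d / 4) *\<^sub>R v + (d - d / 2 - d / 2) *\<^sub>R br x2 v"
      unfolding cd by (simp only: scaleR_diff_left scaleR_diff_right) simp
    finally show ?thesis by (simp add: e_def power2_eq_square scaleR_add_left)
  qed
  have "e < 0"
  proof (rule ccontr)
    assume "\<not> e < 0"
    define r where "r = sqrt e"
    have rr: "r * r = e" using \<open>\<not> e < 0\<close> by (simp add: r_def)
    show False
    proof (cases "br s v + r *\<^sub>R v = 0")
      case True
      then have "br x2 v = (d / 2 - r) *\<^sub>R v"
        unfolding sb[OF v(1)] by (simp add: scaleR_diff_left algebra_simps eq_neg_iff_add_eq_0)
      then show False using noeig[OF v] by (simp add: span_mul span_base)
    next
      case False
      \<comment> \<open>The identity \<open>(s - r) (s + r) v = 0\<close> exhibits an eigenvector.\<close>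
      let ?u = "br s v + r *\<^sub>R v"
      have u: "?u \<in> eigenplane" using sv v subspace_eigenplane by (simp add: subspace_add subspace_mul)
      have "br s ?u = r *\<^sub>R ?u"
        using rr by (simp add: bilinear_radd[OF bilinear_br] bilinear_rmul[OF bilinear_br] sq scaleR_add_right)
      then have "br x2 ?u = (r + d / 2) *\<^sub>R ?u"
        unfolding sb[OF u] by (simp only: scaleR_add_left diff_eq_eq)
      then have "br x2 ?u \<in> span {?u}" by (simp only:) (simp add: span_mul span_base)
      then show False using noeig[OF u False] by blast
    qed
  qed
  define r where "r = sqrt (- e)"
  have r: "r \<noteq> 0" "r * r = - e" using \<open>e < 0\<close> by (simp_all add: r_def)
  define j where "j = (1 / r) *\<^sub>R s"
  have jl: "j \<in> centralizer" unfolding j_def using s_centralizer subspace_centralizer by (simp add: subspace_mul)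
  have "br j (br j v) = (1 / (r * r)) *\<^sub>R (e *\<^sub>R v)"
    by (simp add: j_def br_simps sq)
  also have "\<dots> = - v" using r \<open>e < 0\<close> by simp
  finally have jj: "br j (br j v) = - v" .
  have "\<exists>a b. k = a *\<^sub>R x1 + b *\<^sub>R j" if "k \<in> centralizer" for k
  proof -
    obtain a b where k: "k = a *\<^sub>R x1 + b *\<^sub>R x2" using x2(2)[OF \<open>k \<in> centralizer\<close>] by blast
    have "x2 = (d / 2) *\<^sub>R x1 + r *\<^sub>R j" using r(1) by (simp add: j_def s_def)
    then have "k = (a + b * (d / 2)) *\<^sub>R x1 + (b * r) *\<^sub>R j"
      unfolding k by (simp add: scaleR_add_right scaleR_add_left)
    then show ?thesis by blast
  qed
  then show thesis by (rule that[OF jl _ v jj])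
qed

text \<open>
  The relations \<open>[x2, y1] = y2\<close> and \<open>[x2, y2] = -y1\<close> are the complex structure; \<open>z = [y1, y2]\<close> spans
  \<open>derived2\<close>. The five vectors span a space of dimension at least five, so they form a basis.
\<close>
lemma s545: "lie_iso_described br s545_basis s545_brackets"
proof -
  obtain j y1 where j: "j \<in> centralizer" "\<And>k. k \<in> centralizer \<Longrightarrow> \<exists>a b. k = a *\<^sub>R x1 + b *\<^sub>R j"
    and y1: "y1 \<in> eigenplane" "y1 \<noteq> 0" and jj: "br j (br j y1) = - y1"
    using complex_structure by metis
  define y2 where "y2 = br j y1"
  define z where "z = br y1 y2"
  have y2: "y2 \<in> eigenplane" unfolding y2_def by (rule centralizer_br_eigenplane[OF j(1) y1(1)])
  note dy = eigenplane_derived[OF y1(1)] eigenplane_derived[OF y2]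
  have zd: "z \<in> derived2" unfolding z_def by (rule br_in_derived2[OF dy])
  have y2_span: "y2 \<notin> span {y1}"
  proof
    assume "y2 \<in> span {y1}"
    then obtain c where "y2 = c *\<^sub>R y1" by (auto simp: span_singleton)
    then have "(c * c) *\<^sub>R y1 = - y1" using jj by (simp add: br_simps flip: y2_def)
    then have "(c * c + 1) *\<^sub>R y1 = 0" by (simp add: scaleR_add_left)
    moreover have "c * c + 1 > 0" by (intro add_nonneg_pos) simp_all
    ultimately show False using y1(2) by simp
  qed
  have plane: "\<exists>a b. v = a *\<^sub>R y1 + b *\<^sub>R y2" if "v \<in> eigenplane" for v
    using plane_spanned[OF subspace_eigenplane dim_eigenplane y1 y2 y2_span that] by metis
  have "derived2 \<subseteq> span {z}"
  proof (rule derived2_subset)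
    fix u w assume "u \<in> derived" "w \<in> derived"
    obtain v c where u: "v \<in> eigenplane" "c \<in> derived2" "u = v + c"
      by (rule derived_decomposition[OF \<open>u \<in> derived\<close>])
    obtain v' c' where w: "v' \<in> eigenplane" "c' \<in> derived2" "w = v' + c'"
      by (rule derived_decomposition[OF \<open>w \<in> derived\<close>])
    obtain a b where v: "v = a *\<^sub>R y1 + b *\<^sub>R y2" using plane[OF u(1)] by blast
    obtain a' b' where v': "v' = a' *\<^sub>R y1 + b' *\<^sub>R y2" using plane[OF w(1)] by blast
    have "br u w = br v v'"
      using derived2_central(2)[OF \<open>w \<in> derived\<close> u(2)] derived2_central(1)[OF eigenplane_derived[OF u(1)] w(2)]
      by (simp add: u(3) w(3) br_simps)
    also have "\<dots> = (a * b' - b * a') *\<^sub>R z"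
      using br_anti[of y2 y1] by (simp add: v v' br_simps br_self z_def algebra_simps)
    finally show "br u w \<in> span {z}" by (simp add: span_mul span_base)
  qed simp
  define e where "e g = (case g of gx i \<Rightarrow> if i = 1 then x1 else j
      | gy i \<Rightarrow> if i = 1 then y1 else y2 | gz \<Rightarrow> z)" for g
  have e: "e (gx 1) = x1" "e (gx 2) = j" "e (gy 1) = y1" "e (gy 2) = y2" "e gz = z"
    by (simp_all add: e_def)
  have eB: "e ` s545_basis = {x1, j, y1, y2, z}" by (auto simp: s545_basis_def e_def)
  have fin: "finite s545_basis" and cB: "card s545_basis = 5" by (simp_all add: s545_basis_def)
  have sp: "span (e ` s545_basis) = UNIV"
  proof -
    have "x \<in> span {x1, j, y1, y2, z}" for x
    proof -
      obtain k v c where x: "k \<in> centralizer" "v \<in> eigenplane" "c \<in> derived2" "x = k + v + c"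
        by (rule centralizer_decomposition)
      obtain a b where k: "k = a *\<^sub>R x1 + b *\<^sub>R j" using j(2)[OF x(1)] by blast
      obtain a' b' where v: "v = a' *\<^sub>R y1 + b' *\<^sub>R y2" using plane[OF x(2)] by blast
      obtain t where c: "c = t *\<^sub>R z"
        using x(3) \<open>derived2 \<subseteq> span {z}\<close> by (auto simp: span_singleton)
      show ?thesis unfolding x(4) k v c
        by (intro span_add span_mul span_base) auto
    qed
    then show ?thesis unfolding eB by blast
  qed
  have "DIM('a) \<le> card (e ` s545_basis)"
    using dim_le_card[of UNIV "e ` s545_basis"] sp fin by simp
  moreover have "card (e ` s545_basis) \<le> 5" using card_image_le[OF fin, of e] cB by simp
  ultimately have card5: "card (e ` s545_basis) = 5" "DIM('a) = 5" using dim_ge_5 by auto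
  have inj: "inj_on e s545_basis" by (rule eq_card_imp_inj_on[OF fin]) (simp add: card5 cB)
  have ind: "independent (e ` s545_basis)"
    using card_eq_dim[of "e ` s545_basis" UNIV] sp fin card5 by simp
  have b: "br x1 y1 = y1" "br x1 y2 = y2" "br x1 z = 2 *\<^sub>R z" "br j y1 = y2" "br j y2 = - y1"
      "br y1 y2 = z" "br x1 j = 0" "br y1 z = 0" "br y2 z = 0"
    using eigenplane_br[OF y1(1)] eigenplane_br[OF y2] x1_derived2[OF zd] jj
      centralizer_abelian[OF x1_centralizer j(1)] derived2_central(1)[OF dy(1) zd] derived2_central(1)[OF dy(2) zd]
    by (simp_all add: y2_def z_def)
  have jz: "br j z = 0"
    using br_derivation[of j y1 y2] b by (simp add: br_simps br_self)
  have b': "br j x1 = 0" "br z y1 = 0" "br z y2 = 0" "br z j = 0"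
    using b jz br_anti[of j x1] br_anti[of z y1] br_anti[of z y2] br_anti[of z j] by simp_all
  have rel: "\<forall>(a, b, c, d)\<in>s545_brackets. br (e a) (e b) = c *\<^sub>R e d"
    by (simp only: s545_brackets_def ball_simps prod.case e b) simp
  have zero: "br (e a) (e b) = 0"
    if "a \<in> s545_basis" "b \<in> s545_basis"
      and "\<forall>c d. (a, b, c, d) \<notin> s545_brackets \<and> (b, a, c, d) \<notin> s545_brackets" for a b
    using that unfolding s545_basis_def s545_brackets_def
    by (elim insertE emptyE) (simp_all add: e[simplified] b b' jz br_self)
  show ?thesis
    unfolding lie_iso_described_def
    using inj ind sp rel zero by (intro exI[of _ e]) blast
qed

end

section \<open>The classification\<close>

text \<open>
  A functional that does not vanish on all brackets has a radical different from the whole space, so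
  its orbit is nontrivial and has dimension \<open>n - 1\<close>; the radical is then a line.
\<close>
lemma MD_imp_line_radical_algebra:
  fixes br :: "'a::euclidean_space \<Rightarrow> 'a \<Rightarrow> 'a"
  assumes n: "n \<ge> 4" and MD: "MD_kn_algebra (n - 1) n br"
  shows "line_radical_algebra br"
proof -
  have dn: "DIM('a) = n" and MDk: "MD_k_algebra (n - 1) br"
    using MD unfolding MD_kn_algebra_def by blast+
  have lie: "real_lie_algebra br" and solv: "solvable_lie br"
    and same: "\<And>\<Omega> \<Omega>'. \<Omega> \<in> nontrivial_orbits br \<Longrightarrow> \<Omega>' \<in> nontrivial_orbits br \<Longrightarrow> orbit_dim br \<Omega> = orbit_dim br \<Omega>'"
    using MDk unfolding MD_k_algebra_def MD_algebra_def by blast+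
  obtain \<Omega> where \<Omega>: "\<Omega> \<in> nontrivial_orbits br" "orbit_dim br \<Omega> = n - 1"
    using MDk unfolding MD_k_algebra_def by blast
  interpret real_lie_algebra br by (rule lie)
  obtain F where F: "\<Omega> = coadjoint_orbit br F"
    using \<Omega>(1) by (auto simp: nontrivial_orbits_def coadjoint_orbits_def)
  have "\<exists>u v. br u v \<noteq> 0"
  proof (rule ccontr)
    assume "\<nexists>u v. br u v \<noteq> 0"
    then have "radical (blinfun_apply F) = UNIV" by (auto simp: radical_def blinfun.zero_right)
    then show False using orbit_dim_eq_rank[of F] \<Omega>(2) F n by simp
  qed
  moreover have "dim (radical f) = 1" if f: "linear f" "f (br u v) \<noteq> 0" for f u v
  proof -
    have "bounded_linear f" using f(1) by (simp add: linear_conv_bounded_linear)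
    then have ap: "blinfun_apply (Blinfun f) = f" by (rule bounded_linear_Blinfun_apply)
    let ?O = "coadjoint_orbit br (Blinfun f)"
    have od: "orbit_dim br ?O + dim (radical f) = n"
      using orbit_dim_eq_rank[of "Blinfun f"] by (simp add: ap dn)
    have sub: "subspace (radical f)"
      using f(1) unfolding radical_def subspace_def
      by (auto simp: br_simps linear_add linear_cmul linear_0)
    have "dim (radical f) \<noteq> DIM('a)"
    proof
      assume "dim (radical f) = DIM('a)"
      then have "radical f = UNIV" using sub by (intro subspace_dim_equal) auto
      then show False using f(2) by (auto simp: radical_def)
    qed
    then have "orbit_dim br ?O \<noteq> 0" using od dn by simp
    then have "?O \<in> nontrivial_orbits br" by (auto simp: nontrivial_orbits_def coadjoint_orbits_def)
    then have "orbit_dim br ?O = n - 1" using same[OF _ \<Omega>(1)] \<Omega>(2) by simp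
    then show ?thesis using od n by simp
  qed
  ultimately show ?thesis
    using solv n dn by (intro line_radical_algebra.intro line_radical_algebra_axioms.intro lie) auto
qed

theorem theorem3p6:
  fixes br :: "'a::euclidean_space \<Rightarrow> 'a \<Rightarrow> 'a" and n :: nat
  assumes "n \<ge> 4"
    and "MD_kn_algebra (n - 1) n br"
    and "\<not> decomposable br"
  shows "(\<exists>m\<ge>1. lie_iso_described br (heisenberg_basis m) (heisenberg_brackets m)) \<or>
         lie_iso_described br s545_basis s545_brackets"
proof -
  interpret line_radical_algebra br by (rule MD_imp_line_radical_algebra[OF assms(1,2)])
  show ?thesis
  proof (cases "dim derived \<ge> 2")
    case False
    obtain u v where "br u v \<noteq> 0" using noncommutative by blast
    then have "\<not> derived \<subseteq> {0}" using br_in_derived by blast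
    then have nz: "dim derived \<noteq> 0" by simp
    have "dim derived = 1" using False nz by linarith
    then show ?thesis using heisenberg_or_decomposable[OF _ assms(3)] by blast
  next
    case True
    obtain p where p: "linear p" "\<And>v. v \<in> derived2 \<Longrightarrow> p v = 0" "\<And>x. x - p x \<in> derived2"
      using projection_modulo_derived2 by metis
    interpret derived_plane br p
      by (intro derived_plane.intro derived_plane_axioms.intro line_radical_algebra_axioms p True)
    obtain x1 where x1: "\<And>v. v \<in> quotient_plane \<Longrightarrow> p (br x1 v) = v" using grading_element_exists by blast
    interpret graded_algebra br p x1
      by (intro graded_algebra.intro graded_algebra_axioms.intro derived_plane_axioms x1 assms(3))
    show ?thesis using s545 by blast
  qed
qed

end
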